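(* Let $f:\mathbb{R}^d\to\mathbb{R}$ be twice differentiable and $\mu$-strongly convex with $\mu>0$, let $\nabla f$ be Lipschitz continuous with constant $L>0$, and let $\nabla^2 f$ be Lipschitz continuous with constant $M>0$ (i.e. $\|\nabla^2f(x)-\nabla^2f(y)\|\le M\|x-y\|$ for all $x,y$). Let $\kappa=L/\mu$ and let $x_*$ be the minimizer of $f$. Let $\{x_t\}_{t\ge0}$ be the iterates generated by BFGS, where at every iteration the step size satisfies the Armijo-Wolfe conditions with parameters $\alpha,\beta$, and the unit step size $\eta_t=1$ is chosen whenever it satisfies these conditions. Then for any $x_0\in\mathbb{R}^d$, any symmetric positive definite $B_0$, and all $t\ge1$, $$\frac{f(x_t)-f(x_* )}{f(x_0)-f(x_* )}\le\left(\frac{\delta_7\Psi(\tilde B_0)+(\delta_6+\delta_8C_0)\Psi(\bar B_0)+\left(\frac{3\delta_6}{\alpha(1-\beta)}\log\frac{C_0}{\delta_1}+\frac{3\delta_8}{\alpha(1-\beta)}C_0\right)\kappa}{t}\right)^{t},$$ where $\delta_1,\dots,\delta_8$ are the following constants depending only on $\alpha$ and $\beta$: $$\delta_1=\min\left\{\tfrac16,\sqrt{2(1-\alpha)}-1,\tfrac1{\sqrt{1-\beta}}-1\right\},\quad\delta_2=\max\left\{\tfrac78,\tfrac1{\sqrt{2(1-\alpha)}}\right\},\quad\delta_3=\tfrac1{\sqrt{1-\beta}},$$ $$\delta_4=\frac1{\min\{\omega(\delta_2-1),\omega(\delta_3-1)\}},\quad\delta_5=\frac{\max\{2+\frac2{\delta_2},4\delta_3\}}{2\delta_2-1-\delta_1},\quad\delta_6=\log\frac1{2\alpha(1-\beta)},$$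 $$\delta_7=1+\delta_4\delta_6+\delta_5,\quad\delta_8=1+2\delta_7+\frac{2\delta_2-\delta_1-\log\delta_2}{2\delta_2-1-\delta_1},$$ with $\omega(x)=x-\log(1+x)$ for $x>-1$.
   Context: BFGS method: given $x_0\in\mathbb{R}^d$ and a symmetric positive definite $B_0\in\mathbb{R}^{d\times d}$, for $t\ge0$ set $g_t=\nabla f(x_t)$, $d_t=-B_t^{-1}g_t$, $x_{t+1}=x_t+\eta_t d_t$ with step size $\eta_t>0$, $s_t=x_{t+1}-x_t$, $y_t=\nabla f(x_{t+1})-\nabla f(x_t)$, and $$B_{t+1}=B_t-\frac{B_ts_ts_t^\top B_t}{s_t^\top B_ts_t}+\frac{y_ty_t^\top}{s_t^\top y_t}.$$ The iterates are assumed non-optimal ($g_t\neq0$), so that all quantities are well defined. Armijo-Wolfe conditions on $\eta_t$, with parameters $0<\alpha<\beta<1$ and $0<\alpha<\frac12$: $$f(x_t+\eta_td_t)\le f(x_t)+\alpha\eta_t\nabla f(x_t)^\top d_t,\qquad \nabla f(x_t+\eta_td_t)^\top d_t\ge\beta\nabla f(x_t)^\top d_t.$$ For symmetric positive definite $A\in\mathbb{R}^{d\times d}$, $\Psi(A):=\mathrm{Tr}(A)-d-\log\mathrm{Det}(A)$. Also $\bar B_0:=\frac1LB_0$, $\tilde B_0:=\nabla^2f(x_* )^{-1/2}B_0\nabla^2f(x_* )^{-1/2}$, and $C_t:=\frac{M}{\mu^{3/2}}\sqrt{2(f(x_t)-f(x_* ))}$ for $t\ge0$.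
   Formalization: The term log(C_0/δ_1) is replaced by its positive part max{0, log(C_0/δ_1)}; with the plain logarithm the bound is false for C_0 much smaller than δ_1 (the right side becomes negative at t=1). For C_0 ≥ δ_1 the bound is unchanged. *)

theory Defs
  imports "HOL-Analysis.Analysis"
begin

definition strongly_convex :: "real \<Rightarrow> ('a::real_normed_vector \<Rightarrow> real) \<Rightarrow> bool" where
  "strongly_convex \<mu> f \<longleftrightarrow>
     (\<forall>x y. \<forall>u\<in>{0..1}. f ((1 - u) *\<^sub>R x + u *\<^sub>R y)
        \<le> (1 - u) * f x + u * f y - \<mu> / 2 * u * (1 - u) * (norm (x - y))\<^sup>2)"

definition spd :: "real^'n^'n \<Rightarrow> bool" where
  "spd A \<longleftrightarrow> transpose A = A \<and> (\<forall>v. v \<noteq> 0 \<longrightarrow> v \<bullet> (A *v v) > 0)"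

text \<open>Only meaningful for symmetric positive definite \<open>A\<close>, for which the square root exists
  and is unique.\<close>
definition spd_sqrt :: "real^'n^'n \<Rightarrow> real^'n^'n" where
  "spd_sqrt A = (THE R. spd R \<and> R ** R = A)"

definition outer :: "real^'n \<Rightarrow> real^'n \<Rightarrow> real^'n^'n" where
  "outer v w = (\<chi> i j. v $ i * w $ j)"

definition bfgs_update :: "real^'n^'n \<Rightarrow> real^'n \<Rightarrow> real^'n \<Rightarrow> real^'n^'n" where
  "bfgs_update B s y =
     B - (1 / (s \<bullet> (B *v s))) *\<^sub>R (B ** outer s s ** B) + (1 / (s \<bullet> y)) *\<^sub>R outer y y"

definition bfgs_direction :: "real^'n^'n \<Rightarrow> real^'n \<Rightarrow> real^'n" where
  "bfgs_direction B g = - (matrix_inv B *v g)"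

text \<open>\<open>G\<close> is the gradient map, \<open>\<eta>\<close> the sequence of step sizes, \<open>x\<close> and \<open>B\<close> the sequences of
  iterates and of Hessian approximations, started at \<open>x 0\<close> and \<open>B 0\<close>.\<close>
definition bfgs_iteration ::
  "(real^'n \<Rightarrow> real^'n) \<Rightarrow> (nat \<Rightarrow> real) \<Rightarrow> (nat \<Rightarrow> real^'n) \<Rightarrow> (nat \<Rightarrow> real^'n^'n) \<Rightarrow> bool" where
  "bfgs_iteration G \<eta> x B \<longleftrightarrow>
     (\<forall>t. \<eta> t > 0
        \<and> x (Suc t) = x t + \<eta> t *\<^sub>R bfgs_direction (B t) (G (x t))
        \<and> B (Suc t) = bfgs_update (B t) (x (Suc t) - x t) (G (x (Suc t)) - G (x t)))"

definition armijo_wolfe ::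
  "real \<Rightarrow> real \<Rightarrow> (real^'n \<Rightarrow> real) \<Rightarrow> (real^'n \<Rightarrow> real^'n) \<Rightarrow> real^'n \<Rightarrow> real^'n \<Rightarrow> real \<Rightarrow> bool" where
  "armijo_wolfe \<alpha> \<beta> f G x d \<eta> \<longleftrightarrow>
     f (x + \<eta> *\<^sub>R d) \<le> f x + \<alpha> * \<eta> * (G x \<bullet> d)
     \<and> G (x + \<eta> *\<^sub>R d) \<bullet> d \<ge> \<beta> * (G x \<bullet> d)"

definition Psi :: "real^'n^'n \<Rightarrow> real" where
  "Psi A = trace A - real CARD('n) - ln (det A)"

definition omega :: "real \<Rightarrow> real" where
  "omega x = x - ln (1 + x)"

definition \<delta>1 :: "real \<Rightarrow> real \<Rightarrow> real" where
  "\<delta>1 \<alpha> \<beta> = min (1 / 6) (min (sqrt (2 * (1 - \<alpha>)) - 1) (1 / sqrt (1 - \<beta>) - 1))"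

definition \<delta>2 :: "real \<Rightarrow> real" where
  "\<delta>2 \<alpha> = max (7 / 8) (1 / sqrt (2 * (1 - \<alpha>)))"

definition \<delta>3 :: "real \<Rightarrow> real" where
  "\<delta>3 \<beta> = 1 / sqrt (1 - \<beta>)"

definition \<delta>4 :: "real \<Rightarrow> real \<Rightarrow> real" where
  "\<delta>4 \<alpha> \<beta> = 1 / min (omega (\<delta>2 \<alpha> - 1)) (omega (\<delta>3 \<beta> - 1))"

definition \<delta>5 :: "real \<Rightarrow> real \<Rightarrow> real" where
  "\<delta>5 \<alpha> \<beta> = max (2 + 2 / \<delta>2 \<alpha>) (4 * \<delta>3 \<beta>) / (2 * \<delta>2 \<alpha> - 1 - \<delta>1 \<alpha> \<beta>)"

definition \<delta>6 :: "real \<Rightarrow> real \<Rightarrow> real" where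
  "\<delta>6 \<alpha> \<beta> = ln (1 / (2 * \<alpha> * (1 - \<beta>)))"

definition \<delta>7 :: "real \<Rightarrow> real \<Rightarrow> real" where
  "\<delta>7 \<alpha> \<beta> = 1 + \<delta>4 \<alpha> \<beta> * \<delta>6 \<alpha> \<beta> + \<delta>5 \<alpha> \<beta>"

definition \<delta>8 :: "real \<Rightarrow> real \<Rightarrow> real" where
  "\<delta>8 \<alpha> \<beta> = 1 + 2 * \<delta>7 \<alpha> \<beta>
     + (2 * \<delta>2 \<alpha> - \<delta>1 \<alpha> \<beta> - ln (\<delta>2 \<alpha>)) / (2 * \<delta>2 \<alpha> - 1 - \<delta>1 \<alpha> \<beta>)"

text \<open>In the bound, \<open>3 / (\<alpha> * (1 - \<beta>)) * log (C\<^sub>0 / \<delta>1) * \<kappa>\<close> bounds the number of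
  iterations until \<open>C\<^sub>t \<le> \<delta>1\<close>. For \<open>C\<^sub>0 < \<delta>1\<close> that number is zero while the
  logarithm is negative and tends to minus infinity as \<open>x\<^sub>0\<close> approaches the minimizer, which would
  make the bound negative for odd \<open>t\<close>. The logarithm is therefore read as its positive part;
  for \<open>C\<^sub>0 \<ge> \<delta>1\<close> this is the logarithm itself.\<close>
definition ln_pos :: "real \<Rightarrow> real" where
  "ln_pos z = max 0 (ln z)"

end

theory Submission
  imports Defs
begin

text \<open>
  The proof follows the fraction \<open>r\<^sub>k\<close> of the current excess \<open>f x\<^sub>k - f x\<^sub>*\<close> that iteration \<open>k\<close> removes.
  After \<open>t\<close> iterations the relative excess is the product of the factors \<open>1 - r\<^sub>k\<close>, each of which is at
  most \<open>- ln r\<^sub>k\<close>; by the inequality between the arithmetic and the geometric mean the product is at most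
  \<open>(X / t) ^ t\<close> as soon as the sum of the \<open>- ln r\<^sub>k\<close> is at most \<open>X\<close>. A bound \<open>X\<close> that does not grow with
  \<open>t\<close> therefore is superlinear convergence.

  The quasi-Newton matrices enter only through \<open>Psi\<close>. For a positive definite weight \<open>W\<close> the trace and
  the determinant of \<open>W B\<close> change explicitly under a BFGS update (\<open>Psi_bfgs_update\<close>), and up to a secant
  term the increment of \<open>Psi\<close> is at most the logarithm of the squared cosine of the angle between step
  and negative gradient, divided by the curvature along the step. So \<open>ln r\<^sub>k\<close> is bounded below by an
  increment of \<open>Psi\<close>, which telescopes to at least \<open>- Psi (W B\<^sub>0)\<close> since \<open>Psi\<close> is nonnegative, plus terms
  measuring how well the line search and the weight fit the function (\<open>log_ratio_lower\<close>).

  The argument is applied twice. With \<open>W\<close> the inverse of \<open>L\<close> times the identity the secant terms are harmless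
  everywhere, which yields linear convergence after \<open>Psi B_bar\<close> iterations (\<open>linear_phase\<close>). Hence the
  relative variation \<open>C\<^sub>k\<close> of the Hessian between \<open>x\<^sub>k\<close> and the minimizer is summable (\<open>sum_c\<close>) and exceeds
  \<open>\<delta>1\<close> only finitely often (\<open>card_far\<close>). With \<open>W\<close> the inverse Hessian at the minimizer every term is
  sharp up to \<open>C\<^sub>k\<close>, except for the loss in the line search: the factor \<open>2 p\<^sub>k n\<^sub>k\<close>, which is only known to
  be at least \<open>2 \<alpha> (1 - \<beta>)\<close> in general. Write \<open>\<rho>\<^sub>k\<close> for the quotient of the quadratic forms of \<open>B\<^sub>k\<close>
  and of the Hessian at the minimizer along the step. If \<open>C\<^sub>k\<close> is small and \<open>\<rho>\<^sub>k\<close> is close to one, then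
  the unit step satisfies the line search conditions (\<open>unit_step_taken\<close>) and the loss is controlled by
  \<open>omega (\<rho>\<^sub>k - 1)\<close> and \<open>C\<^sub>k\<close>; if \<open>\<rho>\<^sub>k\<close> is far from one, then \<open>omega (\<rho>\<^sub>k - 1)\<close> is bounded away from
  zero and pays for the constant loss. The sum of the \<open>omega (\<rho>\<^sub>k - 1)\<close> is in turn bounded by \<open>Psi B_tilde\<close>
  and the \<open>C\<^sub>k\<close> (\<open>omega_rho_le\<close>). Adding everything gives \<open>X\<close>.

  Counting whole iterations costs an additional one in the number of iterations with \<open>C\<^sub>k > \<delta>1\<close>. It is
  absorbed by the difference between \<open>exp 1\<close> and 3, where 3 is the factor in the bound on the sum of
  the \<open>C\<^sub>k\<close>, and by \<open>\<delta>4 \<delta>1 \<ge> 7\<close> (\<open>rate_slack\<close>, \<open>seven_le_d4_d1\<close>).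
\<close>

section \<open>Symmetric matrices and the spectral theorem\<close>

lemma inner_matrix_vector_symmetric:
  fixes A :: "real^'n^'n"
  assumes "transpose A = A"
  shows "u \<bullet> (A *v v) = v \<bullet> (A *v u)"
  by (metis assms dot_lmul_matrix inner_commute transpose_matrix_vector)

lemma matrix_inv_inverse:
  fixes A :: "real^'n^'n"
  assumes "invertible A"
  shows matrix_inv_right: "A ** matrix_inv A = mat 1"
    and matrix_inv_left: "matrix_inv A ** A = mat 1"
proof -
  have "A ** matrix_inv A = mat 1 \<and> matrix_inv A ** A = mat 1"
    unfolding matrix_inv_def
    using assms[unfolded invertible_def] by (rule someI_ex)
  then show "A ** matrix_inv A = mat 1" "matrix_inv A ** A = mat 1" by auto
qed

lemma matrix_inv_unique:
  fixes A :: "real^'n^'n"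
  assumes "A ** A' = mat 1"
  shows "matrix_inv A = A'"
proof -
  have "invertible A" using assms invertible_right_inverse by blast
  then have "matrix_inv A ** (A ** A') = A'"
    by (simp add: matrix_mul_assoc matrix_inv_left)
  then show ?thesis using assms by simp
qed

lemma outer_mult_vector [simp]: "outer v w *v x = (w \<bullet> x) *\<^sub>R v"
  by (simp add: outer_def matrix_vector_mult_def vec_eq_iff inner_vec_def sum_distrib_left
      mult_ac)

lemma transpose_outer [simp]: "transpose (outer v w) = outer w v"
  by (simp add: outer_def transpose_def vec_eq_iff mult.commute)

lemma trace_outer [simp]: "trace (outer v w) = v \<bullet> w"
  by (simp add: outer_def trace_def inner_vec_def)

lemma matrix_mult_outer: "A ** outer v w = outer (A *v v) w"
  by (simp add: matrix_eq flip: matrix_vector_mul_assoc) (simp add: algebra_simps)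

lemma outer_mult_matrix: "outer v w ** A = outer v (transpose A *v w)"
  by (simp add: matrix_eq dot_lmul_matrix flip: matrix_vector_mul_assoc)

lemma trace_scaleR: "trace (c *\<^sub>R A :: real^'n^'n) = c * trace A"
  by (simp add: trace_def sum_distrib_left)

lemma transpose_add: "transpose (A + B :: real^'n^'m) = transpose A + transpose B"
  by (simp add: transpose_def vec_eq_iff)

lemma transpose_diff: "transpose (A - B :: real^'n^'m) = transpose A - transpose B"
  by (simp add: transpose_def vec_eq_iff)

lemma matrix_add_rdistrib: "(B + C) ** A = B ** A + C ** A" for A B C :: "real^'n^'n"
  by (simp add: matrix_matrix_mult_def vec_eq_iff sum.distrib algebra_simps)

text \<open>
  An orthogonal change of basis makes \<open>w\<close> a multiple of a coordinate vector. The perturbation then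
  alters a single column of the identity, and the determinant can be read off from Cramer's rule.
\<close>

lemma det_id_plus_outer:
  fixes u w :: "real^'n"
  shows "det (mat 1 + outer u w) = 1 + w \<bullet> u"
proof (cases "w = 0")
  case True
  then have "outer u w = 0" by (simp add: outer_def vec_eq_iff)
  then show ?thesis using True by simp
next
  case False
  then obtain Q :: "real^'n^'n" and k where Q: "orthogonal_matrix Q"
    and Qk: "Q *v axis k 1 = w /\<^sub>R norm w"
    using orthogonal_matrix_exists_basis[of "w /\<^sub>R norm w"]
    by (metis norm_sgn sgn_div_norm)
  define c where "c = norm w"
  have QQ: "transpose Q ** Q = mat 1" "Q ** transpose Q = mat 1"
    using Q by (auto simp: orthogonal_matrix_def)
  have w: "w = c *\<^sub>R (Q *v axis k 1)" using False by (simp add: Qk c_def)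
  have QTw: "transpose Q *v w = c *\<^sub>R axis k 1"
    unfolding w matrix_vector_mult_scaleR
    by (simp only: matrix_vector_mul_assoc QQ matrix_vector_mul_lid)
  let ?u = "transpose Q *v u"
  let ?D = "mat 1 + outer ?u (c *\<^sub>R axis k 1)"
  have conj: "transpose Q ** (mat 1 + outer u w) ** Q = ?D"
    by (simp only: matrix_add_ldistrib matrix_add_rdistrib matrix_mul_rid QQ matrix_mult_outer
        outer_mult_matrix QTw)
  have detQ: "det (transpose Q) * det Q = 1"
    by (metis QQ(1) det_I det_mul)
  have D: "?D = (\<chi> i j. if j = k then (mat 1 *v (axis k 1 + c *\<^sub>R ?u)) $ i else mat 1 $ i $ j)"
    unfolding matrix_vector_mul_lid by (auto simp: vec_eq_iff outer_def mat_def axis_def)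
  have "det ?D = (axis k 1 + c *\<^sub>R ?u) $ k"
    unfolding D cramer_lemma by simp
  also have "\<dots> = 1 + w \<bullet> u"
  proof -
    have "w \<bullet> u = c * (axis k 1 \<bullet> ?u)"
      using QTw by (metis dot_lmul_matrix inner_commute inner_scaleR_left transpose_matrix_vector
          w inner_commute)
    then show ?thesis by (simp add: inner_axis')
  qed
  finally have "det (transpose Q) * det (mat 1 + outer u w) * det Q = 1 + w \<bullet> u"
    unfolding conj[symmetric] det_mul .
  moreover have "det (transpose Q) * det (mat 1 + outer u w) * det Q
    = (det (transpose Q) * det Q) * det (mat 1 + outer u w)" by (simp only: mult_ac)
  ultimately show ?thesis using detQ by simp
qed

text \<open>
  A maximizer \<open>v\<close> of the quadratic form on the unit sphere of an invariant subspace is an eigenvector: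
  moving from \<open>v\<close> along the residual \<open>u = A v - l v\<close> would increase the form to first order unless
  \<open>u = 0\<close>.
\<close>

lemma selfadjoint_eigenvector:
  fixes A :: "real^'n^'n"
  assumes sym: "transpose A = A" and S: "subspace S" and inv: "\<And>v. v \<in> S \<Longrightarrow> A *v v \<in> S"
    and nz: "a \<in> S" "a \<noteq> 0"
  obtains v l where "v \<in> S" "norm v = 1" "A *v v = l *\<^sub>R v"
proof -
  let ?K = "sphere 0 1 \<inter> S"
  have "compact ?K" by (intro compact_Int_closed closed_subspace S) simp
  moreover have "a /\<^sub>R norm a \<in> ?K" using nz S by (auto simp: subspace_scale)
  then have "?K \<noteq> {}" by blast
  moreover have "continuous_on ?K (\<lambda>v. v \<bullet> (A *v v))"
    by (intro continuous_on_inner continuous_on_id matrix_vector_mult_linear_continuous_on)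
  ultimately have "\<exists>v\<in>?K. \<forall>w\<in>?K. w \<bullet> (A *v w) \<le> v \<bullet> (A *v v)"
    by (rule continuous_attains_sup)
  then obtain v where v: "v \<in> ?K" and mx: "\<And>w. w \<in> ?K \<Longrightarrow> w \<bullet> (A *v w) \<le> v \<bullet> (A *v v)"
    by blast
  define l where "l = v \<bullet> (A *v v)"
  have le: "w \<bullet> (A *v w) \<le> l * (w \<bullet> w)" if "w \<in> S" for w
  proof (cases "w = 0")
    case False
    have "w /\<^sub>R norm w \<in> ?K" using that False S by (auto simp: subspace_scale)
    from mx[OF this] have "w \<bullet> (A *v w) / (norm w)\<^sup>2 \<le> l"
      by (simp add: matrix_vector_mult_scaleR l_def power2_eq_square divide_simps)
    then show ?thesis using False by (simp add: divide_simps power2_norm_eq_inner)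
  qed simp
  define u where "u = A *v v - l *\<^sub>R v"
  have uS: "u \<in> S" unfolding u_def using v S inv by (auto intro: subspace_diff subspace_scale)
  define q where "q = l * (u \<bullet> u) - u \<bullet> (A *v u)"
  have vv: "v \<bullet> v = 1" using v by (simp add: norm_eq_1)
  have key: "2 * s * (u \<bullet> u) \<le> s\<^sup>2 * q" for s
  proof -
    have "v + s *\<^sub>R u \<in> S" using v uS S by (auto intro: subspace_add subspace_scale)
    from le[OF this] have "v \<bullet> (A *v v) + 2 * s * (u \<bullet> (A *v v)) + s\<^sup>2 * (u \<bullet> (A *v u))
      \<le> l * (1 + 2 * s * (u \<bullet> v) + s\<^sup>2 * (u \<bullet> u))"
      using inner_matrix_vector_symmetric[OF sym, of u v] vv
      by (simp add: algebra_simps inner_simps power2_eq_square inner_commute)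
    moreover have "u \<bullet> (A *v v) = u \<bullet> u + l * (u \<bullet> v)"
      by (simp add: u_def inner_simps algebra_simps)
    ultimately show ?thesis by (simp add: q_def l_def algebra_simps)
  qed
  have "u \<bullet> u \<le> 0"
  proof (rule ccontr)
    assume "\<not> u \<bullet> u \<le> 0"
    then have p: "u \<bullet> u > 0" by (simp only: not_le)
    \<comment> \<open>Any smaller step would do: it makes the first-order gain exceed the second-order loss.\<close>
    define s where "s = (u \<bullet> u) / (1 + \<bar>q\<bar>)"
    have s: "s > 0" using p by (simp add: s_def)
    have "2 * (u \<bullet> u) \<le> s * q" using key[of s] s by (simp add: power2_eq_square)
    also have "\<dots> \<le> s * (1 + \<bar>q\<bar>)" using s by (intro mult_left_mono) auto
    also have "\<dots> = u \<bullet> u" by (simp add: s_def)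
    finally show False using p by simp
  qed
  then have "u = 0" by (metis inner_ge_zero inner_eq_zero_iff order_antisym)
  then show ?thesis using that[of v l] v by (auto simp: u_def)
qed

text \<open>
  The orthogonal complement of a set of eigenvectors is invariant, so \<open>selfadjoint_eigenvector\<close> extends
  any orthonormal set of eigenvectors that is too small to span the space.
\<close>

lemma orthonormal_eigenvectors:
  fixes A :: "real^'n^'n"
  assumes sym: "transpose A = A" and "k \<le> CARD('n)"
  shows "\<exists>b. finite b \<and> card b = k \<and> pairwise orthogonal b \<and>
    (\<forall>v\<in>b. norm v = 1 \<and> (\<exists>l. A *v v = l *\<^sub>R v))"
  using assms(2)
proof (induction k)
  case 0
  show ?case by (rule exI[of _ "{}"]) simp
next
  case (Suc k)
  then obtain b where b: "finite b" "card b = k" "pairwise orthogonal b"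
    "\<And>v. v \<in> b \<Longrightarrow> norm v = 1" "\<And>v. v \<in> b \<Longrightarrow> \<exists>l. A *v v = l *\<^sub>R v" by auto
  define S where "S = {w. \<forall>v\<in>b. orthogonal v w}"
  have S: "subspace S" by (auto simp: S_def subspace_def orthogonal_clauses)
  have inv: "A *v w \<in> S" if "w \<in> S" for w
    using that b(5) unfolding S_def orthogonal_def
    by (auto simp: inner_matrix_vector_symmetric[OF sym, of _ w]) (metis inner_commute inner_scaleR_right mult_zero_right)
  have "dim b < DIM(real^'n)"
    using b(1,2) Suc.prems dim_le_card'[OF b(1)] by simp
  then obtain a where "a \<noteq> 0" "\<And>y. y \<in> span b \<Longrightarrow> orthogonal a y"
    using orthogonal_to_subspace_exists[of b] by blast
  then have "a \<in> S" by (auto simp: S_def orthogonal_commute span_base)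
  then obtain v l where v: "v \<in> S" "norm v = 1" "A *v v = l *\<^sub>R v"
    using selfadjoint_eigenvector[OF sym S inv _ \<open>a \<noteq> 0\<close>] by blast
  have "v \<notin> b" using v by (auto simp: S_def orthogonal_self)
  moreover have "pairwise orthogonal (insert v b)"
    using b(3) v(1) by (auto simp: pairwise_insert S_def orthogonal_commute)
  ultimately show ?case using b v by (intro exI[of _ "insert v b"]) auto
qed

definition diag :: "('n \<Rightarrow> real) \<Rightarrow> real^'n^'n" where
  "diag l = (\<chi> i j. if i = j then l i else 0)"

lemma diag_mult: "diag l ** diag m = diag (\<lambda>i. l i * m i)"
  by (simp add: diag_def matrix_matrix_mult_def vec_eq_iff if_distrib[where f = "\<lambda>x. _ * x"]
      if_distrib[where f = "\<lambda>x. x * _"] cong: if_cong)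

lemma transpose_diag [simp]: "transpose (diag l) = diag l"
  by (auto simp: diag_def transpose_def vec_eq_iff)

lemma diag_mult_vector: "(diag l *v v) $ i = l i * v $ i"
  by (simp add: diag_def matrix_vector_mult_def if_distrib[where f = "\<lambda>x. x * _"] cong: if_cong)

lemma trace_diag: "trace (diag l) = sum l UNIV"
  by (simp add: diag_def trace_def)

lemma det_diag: "det (diag l) = prod l UNIV"
  by (subst det_diagonal) (auto simp: diag_def)

theorem spectral_decomposition:
  fixes A :: "real^'n^'n"
  assumes sym: "transpose A = A"
  obtains Q l where "orthogonal_matrix Q" "A = Q ** diag l ** transpose Q"
proof -
  obtain b where b: "finite b" "card b = CARD('n)" "pairwise orthogonal b"
    "\<And>v. v \<in> b \<Longrightarrow> norm v = 1" "\<And>v. v \<in> b \<Longrightarrow> \<exists>l. A *v v = l *\<^sub>R v"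
    using orthonormal_eigenvectors[OF sym, of "CARD('n)"] by auto
  then obtain e where e: "bij_betw e (UNIV :: 'n set) b"
    by (metis finite_class.finite_UNIV finite_same_card_bij)
  then have eb: "e i \<in> b" for i by (auto simp: bij_betw_def)
  obtain l where l: "\<And>i. A *v e i = l i *\<^sub>R e i" using b(5)[OF eb] by metis
  define Q :: "real^'n^'n" where "Q = (\<chi> i j. e j $ i)"
  have col: "column j Q = e j" for j by (simp add: Q_def column_def vec_eq_iff)
  have Q: "orthogonal_matrix Q"
    unfolding orthogonal_matrix_orthonormal_columns col
  proof (intro conjI allI impI)
    fix i j :: 'n assume "i \<noteq> j"
    then have "e i \<noteq> e j" using e by (metis UNIV_I bij_betw_def inj_on_eq_iff)
    then show "orthogonal (e i) (e j)" using b(3) eb by (simp add: pairwise_def)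
  qed (use b(4) eb in blast)
  have "A ** Q = Q ** diag l"
  proof -
    have "(A ** Q) $ i $ j = (Q ** diag l) $ i $ j" for i j
    proof -
      have "(A ** Q) $ i $ j = (A *v e j) $ i"
        by (simp add: matrix_matrix_mult_def matrix_vector_mult_def Q_def)
      also have "\<dots> = (Q ** diag l) $ i $ j"
        by (simp add: l matrix_matrix_mult_def Q_def diag_def if_distrib mult.commute cong: if_cong)
      finally show ?thesis .
    qed
    then show ?thesis by (simp add: vec_eq_iff)
  qed
  then have "A = Q ** diag l ** transpose Q"
    using Q by (metis matrix_mul_assoc matrix_mul_rid orthogonal_matrix_def)
  then show ?thesis using Q that by blast
qed

section \<open>Positive definite matrices and the potential Psi\<close>

lemma spd_transpose: "spd A \<Longrightarrow> transpose A = A"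
  and spd_pos: "spd A \<Longrightarrow> v \<noteq> 0 \<Longrightarrow> v \<bullet> (A *v v) > 0"
  by (auto simp: spd_def)

lemma spd_nonneg: "spd A \<Longrightarrow> v \<bullet> (A *v v) \<ge> 0"
  by (cases "v = 0") (auto simp: spd_def intro: less_imp_le)

lemma spd_invertible:
  assumes "spd A" shows "invertible A"
proof -
  have "\<And>v. A *v v = 0 \<Longrightarrow> v = 0" using spd_pos[OF assms] by force
  then show ?thesis unfolding invertible_left_inverse matrix_left_invertible_ker by blast
qed

lemma mult_matrix_inv_vector: "spd P \<Longrightarrow> P *v (matrix_inv P *v v) = v"
  by (simp add: matrix_vector_mul_assoc matrix_inv_right spd_invertible)

lemma spd_matrix_inv:
  assumes "spd A" shows "spd (matrix_inv A)"
proof -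
  note inv = matrix_inv_right[OF spd_invertible[OF assms]] matrix_inv_left[OF spd_invertible[OF assms]]
  have "A ** transpose (matrix_inv A) = mat 1"
    by (metis assms inv(2) matrix_transpose_mul spd_transpose transpose_mat)
  then have "transpose (matrix_inv A) = matrix_inv A" by (metis matrix_inv_unique)
  moreover have "v \<bullet> (matrix_inv A *v v) > 0" if "v \<noteq> 0" for v
  proof -
    let ?w = "matrix_inv A *v v"
    have Aw: "A *v ?w = v" by (simp add: matrix_vector_mul_assoc inv)
    then have "?w \<noteq> 0" using that by auto
    then show ?thesis using spd_pos[OF assms, of ?w] Aw by (simp add: inner_commute)
  qed
  ultimately show ?thesis by (simp add: spd_def)
qed

lemma spd_congruence:
  assumes "spd A" and "invertible K" shows "spd (K ** A ** transpose K)"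
proof -
  have "v \<bullet> ((K ** A ** transpose K) *v v) = (transpose K *v v) \<bullet> (A *v (transpose K *v v))" for v
    by (simp add: dot_lmul_matrix flip: matrix_vector_mul_assoc)
  moreover have "transpose K *v v \<noteq> 0" if "v \<noteq> 0" for v
  proof -
    have "invertible (transpose K)"
      using assms(2) unfolding invertible_def by (metis matrix_transpose_mul transpose_mat)
    then show ?thesis
      using that inj_matrix_vector_mult by (metis injD matrix_vector_mult_0_right)
  qed
  moreover have "transpose (K ** A ** transpose K) = K ** A ** transpose K"
    using spd_transpose[OF assms(1)] by (simp add: matrix_transpose_mul matrix_mul_assoc)
  ultimately show ?thesis using assms(1) by (simp add: spd_def)
qed

lemma orthogonal_diag_congruence_spd:
  assumes "orthogonal_matrix Q" and "\<And>i. l i > 0"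
  shows "spd (Q ** diag l ** transpose Q)"
proof (rule spd_congruence)
  show "spd (diag l)"
    unfolding spd_def
  proof (intro conjI allI impI)
    fix v :: "real^'a" assume "v \<noteq> 0"
    then obtain i where "v $ i \<noteq> 0" by (auto simp: vec_eq_iff)
    then have "0 < (\<Sum>i\<in>UNIV. v $ i * (l i * v $ i))"
      using assms(2)
      by (intro sum_pos2[of _ i]) (auto simp: zero_less_mult_iff less_imp_le mult.left_commute)
    then show "0 < v \<bullet> (diag l *v v)" by (simp add: inner_vec_def diag_mult_vector)
  qed simp
  show "invertible Q" using assms(1) by (auto simp: orthogonal_matrix_def invertible_def)
qed

lemma spd_decomposition:
  fixes A :: "real^'n^'n"
  assumes "spd A"
  obtains Q l where "orthogonal_matrix Q" "A = Q ** diag l ** transpose Q" "\<And>i. l i > 0"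
proof -
  obtain Q l where Q: "orthogonal_matrix Q" and A: "A = Q ** diag l ** transpose Q"
    using spectral_decomposition[OF spd_transpose[OF assms]] by blast
  have QQ: "transpose Q ** Q = mat 1" using Q by (simp add: orthogonal_matrix_def)
  have "l i > 0" for i
  proof -
    let ?v = "Q *v axis i 1"
    have Tv: "transpose Q *v ?v = axis i 1"
      by (simp only: matrix_vector_mul_assoc QQ matrix_vector_mul_lid)
    then have "?v \<noteq> 0" by (metis axis_eq_0_iff matrix_vector_mult_0_right one_neq_zero)
    then have "0 < ?v \<bullet> (A *v ?v)" by (rule spd_pos[OF assms])
    also have "\<dots> = (transpose Q *v ?v) \<bullet> (diag l *v (transpose Q *v ?v))"
      unfolding A by (simp add: dot_lmul_matrix flip: matrix_vector_mul_assoc)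
    also have "\<dots> = l i" unfolding Tv by (simp add: inner_axis' diag_mult_vector)
    finally show ?thesis .
  qed
  with Q A that show ?thesis by blast
qed

lemma spd_det_pos:
  assumes "spd A" shows "det A > 0"
proof -
  obtain Q l where Q: "orthogonal_matrix Q" "A = Q ** diag l ** transpose Q" "\<And>i. l i > 0"
    using spd_decomposition[OF assms] by blast
  have "det Q * det Q = 1" using det_orthogonal_matrix[OF Q(1)] by auto
  moreover have "det A = (det Q * det Q) * prod l UNIV"
    unfolding Q(2) det_mul det_transpose det_diag by (simp only: mult_ac)
  ultimately have "det A = prod l UNIV" by simp
  then show ?thesis using Q(3) by (simp add: prod_pos)
qed

text \<open>
  In an eigenbasis \<open>Psi\<close> is the sum of \<open>l - 1 - ln l\<close> over the eigenvalues \<open>l\<close>.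
\<close>

lemma Psi_nonneg:
  fixes A :: "real^'n^'n"
  assumes "spd A" shows "Psi A \<ge> 0"
proof -
  obtain Q l where Q: "orthogonal_matrix Q" "A = Q ** diag l ** transpose Q" "\<And>i. l i > 0"
    using spd_decomposition[OF assms] by blast
  have QQ: "det Q * det Q = 1" using det_orthogonal_matrix[OF Q(1)] by auto
  moreover have "det A = (det Q * det Q) * prod l UNIV"
    unfolding Q(2) det_mul det_transpose det_diag by (simp only: mult_ac)
  ultimately have d: "det A = prod l UNIV" by simp
  have "trace A = trace (transpose Q ** Q ** diag l)"
    unfolding Q(2) by (metis trace_mul_sym matrix_mul_assoc)
  then have t: "trace A = sum l UNIV"
    using Q(1) by (simp add: orthogonal_matrix_def trace_diag)
  have "Psi A = (\<Sum>i\<in>UNIV. l i - 1 - ln (l i))"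
    unfolding Psi_def d t using Q(3)
    by (subst ln_prod) (auto simp: sum_subtractf less_imp_neq[symmetric])
  also have "\<dots> \<ge> 0" using Q(3) by (intro sum_nonneg) (use ln_le_minus_one in \<open>force simp: algebra_simps\<close>)
  finally show ?thesis .
qed

lemma spd_sqrt_exists:
  assumes "spd A" obtains R where "spd R" "R ** R = A"
proof -
  obtain Q l where Q: "orthogonal_matrix Q" "A = Q ** diag l ** transpose Q" "\<And>i. l i > 0"
    using spd_decomposition[OF assms] by blast
  define D where "D = diag (\<lambda>i. sqrt (l i))"
  have "D ** D = diag l" using Q(3) by (simp add: D_def diag_mult less_imp_le)
  moreover have "(Q ** D ** transpose Q) ** (Q ** D ** transpose Q)
    = Q ** D ** (transpose Q ** Q) ** D ** transpose Q" by (simp only: matrix_mul_assoc)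
  ultimately have "(Q ** D ** transpose Q) ** (Q ** D ** transpose Q) = A"
    using Q(1,2) by (simp add: orthogonal_matrix_def) (metis matrix_mul_assoc)
  moreover have "spd (Q ** D ** transpose Q)"
    unfolding D_def using Q by (intro orthogonal_diag_congruence_spd) auto
  ultimately show ?thesis using that by blast
qed

text \<open>
  With \<open>D = R - S\<close>, equality of the squares means \<open>R D + D S = 0\<close>. Testing this with an eigenvector of
  \<open>D\<close> shows that its eigenvalue times the positive number \<open>v\<^sup>T R v + v\<^sup>T S v\<close> vanishes.
\<close>

lemma spd_sqrt_unique:
  fixes R S :: "real^'n^'n"
  assumes "spd R" "spd S" "R ** R = S ** S"
  shows "R = S"
proof -
  define D where "D = R - S"
  have "transpose D = D" using assms by (simp add: D_def transpose_diff spd_transpose)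
  then obtain Q l where Q: "orthogonal_matrix Q" and D: "D = Q ** diag l ** transpose Q"
    using spectral_decomposition by blast
  have QQ: "transpose Q ** Q = mat 1" using Q by (simp add: orthogonal_matrix_def)
  have RD: "R *v (D *v v) + D *v (S *v v) = 0" for v
  proof -
    have "R *v (R *v v) = S *v (S *v v)" using assms(3) by (simp add: matrix_vector_mul_assoc)
    then show ?thesis
      by (simp add: D_def matrix_vector_mult_diff_rdistrib matrix_vector_mult_diff_distrib)
  qed
  have "l i = 0" for i
  proof -
    define v where "v = Q *v axis i 1"
    have Tv: "transpose Q *v v = axis i 1"
      unfolding v_def by (simp only: matrix_vector_mul_assoc QQ matrix_vector_mul_lid)
    then have vnz: "v \<noteq> 0" by (metis axis_eq_0_iff matrix_vector_mult_0_right one_neq_zero)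
    have "diag l *v axis i 1 = l i *\<^sub>R axis i 1"
      by (auto simp: vec_eq_iff diag_mult_vector axis_def)
    then have Dv: "D *v v = l i *\<^sub>R v"
      unfolding D using Tv by (simp add: v_def algebra_simps flip: matrix_vector_mul_assoc)
    have "v \<bullet> (D *v (S *v v)) = (D *v v) \<bullet> (S *v v)"
      using \<open>transpose D = D\<close> by (metis dot_lmul_matrix transpose_matrix_vector)
    then have "l i * (v \<bullet> (R *v v) + v \<bullet> (S *v v)) = 0"
      using arg_cong[OF RD[of v], of "\<lambda>z. v \<bullet> z"] Dv by (simp add: inner_simps algebra_simps)
    moreover have "v \<bullet> (R *v v) + v \<bullet> (S *v v) > 0" using assms vnz by (simp add: add_pos_pos spd_pos)
    ultimately show ?thesis by simp
  qed
  then have "diag l = 0" by (simp add: diag_def vec_eq_iff)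
  then show ?thesis using D D_def by (simp add: matrix_matrix_mult_def vec_eq_iff)
qed

lemma spd_sqrt_spd: "spd A \<Longrightarrow> spd (spd_sqrt A)"
  and spd_sqrt_square: "spd A \<Longrightarrow> spd_sqrt A ** spd_sqrt A = A"
proof -
  assume A: "spd A"
  have "\<exists>!R. spd R \<and> R ** R = A"
    using spd_sqrt_exists[OF A] spd_sqrt_unique by metis
  from theI'[OF this] show "spd (spd_sqrt A)" "spd_sqrt A ** spd_sqrt A = A"
    by (auto simp: spd_sqrt_def)
qed

lemma Psi_mult_commute: "Psi (A ** B) = Psi (B ** A)" for A B :: "real^'n^'n"
  by (simp add: Psi_def trace_mul_sym[of A B] det_mul mult.commute)

text \<open>
  Although \<open>W B\<close> need not be symmetric, its trace and determinant are those of the positive definite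
  matrix \<open>R B R\<close> with \<open>R\<^sup>2 = W\<close>. All potentials are therefore written in the form \<open>Psi (W ** B)\<close>, and
  square roots occur only here and in the following lemma.
\<close>

lemma Psi_mult_nonneg:
  assumes "spd W" "spd B" shows "Psi (W ** B) \<ge> 0"
proof -
  let ?R = "spd_sqrt W"
  have "spd (?R ** B ** transpose ?R)"
    using assms by (intro spd_congruence spd_invertible spd_sqrt_spd)
  then have "Psi (?R ** B ** ?R) \<ge> 0"
    using Psi_nonneg spd_transpose[OF spd_sqrt_spd[OF assms(1)]] by metis
  also have "Psi (?R ** B ** ?R) = Psi (?R ** (?R ** B))" by (rule Psi_mult_commute)
  also have "\<dots> = Psi (W ** B)" by (simp add: matrix_mul_assoc spd_sqrt_square assms)
  finally show ?thesis .
qed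

lemma Psi_normalized:
  fixes A B :: "real^'n^'n"
  assumes "spd A"
  shows "Psi (matrix_inv (spd_sqrt A) ** B ** matrix_inv (spd_sqrt A)) = Psi (matrix_inv A ** B)"
proof -
  let ?R = "spd_sqrt A" and ?T = "matrix_inv (spd_sqrt A)"
  note inv = matrix_inv_right[OF spd_invertible[OF spd_sqrt_spd[OF assms]]]
  have "A ** (?T ** ?T) = ?R ** (?R ** ?T) ** ?T"
    using spd_sqrt_square[OF assms] by (metis matrix_mul_assoc)
  then have "matrix_inv A = ?T ** ?T" by (intro matrix_inv_unique) (simp add: inv)
  then show ?thesis by (metis Psi_mult_commute matrix_mul_assoc)
qed

lemma spd_cauchy_schwarz:
  assumes "spd A" shows "(u \<bullet> (A *v v))\<^sup>2 \<le> (u \<bullet> (A *v u)) * (v \<bullet> (A *v v))"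
proof (cases "v = 0")
  case False
  define a where "a = v \<bullet> (A *v v)"
  define c where "c = u \<bullet> (A *v v)"
  have a: "a > 0" using spd_pos[OF assms False] by (simp add: a_def)
  have "0 \<le> (a *\<^sub>R u - c *\<^sub>R v) \<bullet> (A *v (a *\<^sub>R u - c *\<^sub>R v))" by (rule spd_nonneg[OF assms])
  also have "\<dots> = a * (a * (u \<bullet> (A *v u)) - c\<^sup>2)"
    using inner_matrix_vector_symmetric[OF spd_transpose[OF assms], of v u]
    by (simp add: algebra_simps inner_simps power2_eq_square c_def a_def)
  finally show ?thesis using a by (simp add: zero_le_mult_iff a_def c_def mult.commute)
qed simp

section \<open>The effect of one BFGS update\<close>

text \<open>
  Both facts come from one explicit factorization of the updated matrix as \<open>J J\<^sup>T\<close>.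
\<close>

lemma
  fixes B :: "real^'n^'n"
  assumes B: "spd B" and sy: "s \<bullet> y > 0"
  shows spd_bfgs_update: "spd (bfgs_update B s y)"
    and det_bfgs_update: "det (bfgs_update B s y) = det B * (s \<bullet> y) / (s \<bullet> (B *v s))"
proof -
  obtain K where K: "spd K" and KK: "K ** K = B" using spd_sqrt_exists[OF B] by blast
  have KT: "transpose K = K" using K by (rule spd_transpose)
  have s: "s \<noteq> 0" using sy by auto
  define b where "b = s \<bullet> (B *v s)"
  have b: "b > 0" using spd_pos[OF B s] by (simp add: b_def)
  define w where "w = (1 / sqrt b) *\<^sub>R (K *v s)"
  define z where "z = (1 / sqrt (s \<bullet> y)) *\<^sub>R y"
  have Ksb: "(K *v s) \<bullet> (K *v s) = b"
    by (metis KK KT b_def dot_lmul_matrix matrix_vector_mul_assoc transpose_matrix_vector)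
  have ww: "w \<bullet> w = 1" using b Ksb by (simp add: w_def)
  let ?Ki = "matrix_inv K"
  have Ki: "K ** ?Ki = mat 1" "?Ki ** K = mat 1"
    using K matrix_inv_right matrix_inv_left spd_invertible by blast+
  \<comment> \<open>The update is \<open>J J\<^sup>T\<close>, where \<open>J\<close> agrees with \<open>K\<close> on the complement of \<open>w\<close> and sends \<open>w\<close> to \<open>z\<close>:
    the part of \<open>K K\<^sup>T = B\<close> along \<open>w\<close> is exchanged for \<open>z z\<^sup>T\<close>. As \<open>J\<close> is \<open>K\<close> times a rank-one
    perturbation of the identity, its determinant is explicit.\<close>
  define J where "J = K ** (mat 1 + outer (?Ki *v z - w) w)"
  have Jv: "J *v v = K *v v + (w \<bullet> v) *\<^sub>R (z - K *v w)" for v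
    by (simp add: J_def Ki algebra_simps matrix_vector_mul_assoc flip: matrix_vector_mul_assoc[of K "mat 1 + _" v])
  have JTv: "transpose J *v v = K *v v + ((z - K *v w) \<bullet> v) *\<^sub>R w" for v
  proof -
    have "J = K + outer (z - K *v w) w" by (simp add: matrix_eq Jv matrix_vector_mult_add_rdistrib)
    then show ?thesis by (simp add: transpose_add KT matrix_vector_mult_add_rdistrib
          del: transpose_matrix_vector)
  qed
  have Kw: "K *v w = (1 / sqrt b) *\<^sub>R (B *v s)"
    by (simp add: w_def matrix_vector_mult_scaleR matrix_vector_mul_assoc KK)
  have wK: "w \<bullet> (K *v v) = (K *v w) \<bullet> v" for v
    by (metis KT dot_lmul_matrix transpose_matrix_vector)
  have JJ: "J ** transpose J = bfgs_update B s y"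
  proof -
    have "(J ** transpose J) *v v = bfgs_update B s y *v v" for v
    proof -
      have "(J ** transpose J) *v v = B *v v - ((K *v w) \<bullet> v) *\<^sub>R (K *v w) + (z \<bullet> v) *\<^sub>R z"
        unfolding matrix_vector_mul_assoc[symmetric] JTv Jv
        by (simp add: algebra_simps inner_simps ww wK matrix_vector_mul_assoc KK)
      also have "\<dots> = bfgs_update B s y *v v"
        unfolding bfgs_update_def b_def[symmetric] Kw z_def using b sy
        by (simp add: algebra_simps scaleR_matrix_vector_assoc[symmetric] matrix_mult_outer
            outer_mult_matrix spd_transpose[OF B] del: transpose_matrix_vector)
      finally show ?thesis .
    qed
    then show ?thesis by (simp add: matrix_eq)
  qed
  have "w \<bullet> (?Ki *v z - w) = sqrt (s \<bullet> y) / sqrt b - 1"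
  proof -
    have "(K *v s) \<bullet> (?Ki *v z) = s \<bullet> z"
      by (metis KT Ki(1) dot_lmul_matrix matrix_vector_mul_assoc matrix_vector_mul_lid
          transpose_matrix_vector)
    also have "\<dots> = sqrt (s \<bullet> y)" using sy by (simp add: z_def real_div_sqrt)
    finally show ?thesis using ww by (simp add: inner_simps) (simp add: w_def)
  qed
  then have dJ: "det J = det K * (sqrt (s \<bullet> y) / sqrt b)"
    by (simp add: J_def det_mul det_id_plus_outer)
  have "det (bfgs_update B s y) = det J * det J" unfolding JJ[symmetric] by (simp add: det_mul)
  also have "\<dots> = det K * det K * ((sqrt (s \<bullet> y) * sqrt (s \<bullet> y)) / (sqrt b * sqrt b))"
    unfolding dJ by simp
  also have "det K * det K = det B" using KK det_mul by metis
  finally show "det (bfgs_update B s y) = det B * (s \<bullet> y) / (s \<bullet> (B *v s))"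
    using b sy by (simp add: b_def)
  have "det J \<noteq> 0" using spd_det_pos[OF K] b sy unfolding dJ by simp
  then have "invertible J" by (simp add: invertible_det_nz)
  then have "spd (J ** mat 1 ** transpose J)"
    by (intro spd_congruence) (auto simp: spd_def)
  then show "spd (bfgs_update B s y)" by (simp add: JJ)
qed

text \<open>
  Trace and determinant of a rank-two update are explicit; this identity is the only information on the
  matrices \<open>B\<^sub>k\<close> that the convergence proof uses, besides positive definiteness.
\<close>

lemma Psi_bfgs_update:
  fixes W B :: "real^'n^'n"
  assumes W: "spd W" and B: "spd B" and sy: "s \<bullet> y > 0"
  shows "Psi (W ** bfgs_update B s y) = Psi (W ** B)
    - ((B *v s) \<bullet> (W *v (B *v s))) / (s \<bullet> (B *v s)) + (y \<bullet> (W *v y)) / (s \<bullet> y)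
    - ln ((s \<bullet> y) / (s \<bullet> (B *v s)))"
proof -
  have s: "s \<noteq> 0" using sy by auto
  have b: "s \<bullet> (B *v s) > 0" using spd_pos[OF B s] .
  have m: "W ** bfgs_update B s y = W ** B - (1 / (s \<bullet> (B *v s))) *\<^sub>R outer (W *v (B *v s)) (B *v s)
    + (1 / (s \<bullet> y)) *\<^sub>R outer (W *v y) y"
    by (simp add: matrix_eq bfgs_update_def scaleR_matrix_vector_assoc[symmetric] matrix_mult_outer
        outer_mult_matrix spd_transpose[OF B] algebra_simps flip: matrix_vector_mul_assoc
        del: transpose_matrix_vector)
  have t: "trace (W ** bfgs_update B s y) = trace (W ** B)
    - ((B *v s) \<bullet> (W *v (B *v s))) / (s \<bullet> (B *v s)) + (y \<bullet> (W *v y)) / (s \<bullet> y)"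
    unfolding m by (simp add: trace_add trace_sub trace_scaleR inner_commute)
  have d: "ln (det (W ** bfgs_update B s y)) = ln (det (W ** B)) + ln ((s \<bullet> y) / (s \<bullet> (B *v s)))"
  proof -
    have "det (W ** bfgs_update B s y) = det (W ** B) * ((s \<bullet> y) / (s \<bullet> (B *v s)))"
      using det_bfgs_update[OF B sy] by (simp add: det_mul)
    moreover have "det (W ** B) > 0" using W B by (simp add: det_mul spd_det_pos)
    moreover have "(s \<bullet> y) / (s \<bullet> (B *v s)) > 0" using b sy by simp
    ultimately show ?thesis by (metis ln_mult_pos)
  qed
  show ?thesis unfolding Psi_def t d by simp
qed

section \<open>Strongly convex functions with Lipschitz Hessian\<close>

locale smooth_strongly_convex =
  fixes f :: "real^'n \<Rightarrow> real" and G :: "real^'n \<Rightarrow> real^'n" and H :: "real^'n \<Rightarrow> real^'n^'n"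
    and \<mu> L M :: real and x_star :: "real^'n"
  assumes gradient: "\<And>z. GDERIV f z :> G z"
    and hessian: "\<And>z. (G has_derivative (\<lambda>h. H z *v h)) (at z)"
    and mu_pos: "\<mu> > 0" and strongly_convex: "strongly_convex \<mu> f"
    and L_pos: "L > 0" and lipschitz: "L-lipschitz_on UNIV G"
    and M_pos: "M > 0"
    and hessian_lipschitz: "\<And>z w. onorm (\<lambda>h. (H z - H w) *v h) \<le> M * norm (z - w)"
    and minimizer: "\<And>z. f x_star \<le> f z"
begin

lemma segment_deriv:
  "((\<lambda>\<tau>. f (a + \<tau> *\<^sub>R v)) has_real_derivative G (a + \<tau> *\<^sub>R v) \<bullet> v) (at \<tau>)"
proof -
  have "(f has_derivative (\<lambda>h. h \<bullet> G (a + \<tau> *\<^sub>R v))) (at (a + \<tau> *\<^sub>R v))"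
    using gradient unfolding gderiv_def .
  moreover have "((\<lambda>\<tau>. a + \<tau> *\<^sub>R v) has_derivative (\<lambda>h. h *\<^sub>R v)) (at \<tau>)"
    by (auto intro!: derivative_eq_intros)
  ultimately have "((\<lambda>\<tau>. f (a + \<tau> *\<^sub>R v)) has_derivative (\<lambda>h. (h *\<^sub>R v) \<bullet> G (a + \<tau> *\<^sub>R v))) (at \<tau>)"
    using has_derivative_compose by blast
  then show ?thesis
    by (simp add: has_field_derivative_def inner_commute mult.commute[of _ "_ \<bullet> _"])
qed

lemma segment_gradient_deriv:
  "((\<lambda>\<tau>. G (a + \<tau> *\<^sub>R v) \<bullet> u) has_real_derivative u \<bullet> (H (a + \<tau> *\<^sub>R v) *v v)) (at \<tau>)"
proof -
  have "((\<lambda>\<tau>. a + \<tau> *\<^sub>R v) has_derivative (\<lambda>h. h *\<^sub>R v)) (at \<tau>)"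
    by (auto intro!: derivative_eq_intros)
  then have "((\<lambda>\<tau>. G (a + \<tau> *\<^sub>R v)) has_derivative (\<lambda>h. H (a + \<tau> *\<^sub>R v) *v (h *\<^sub>R v))) (at \<tau>)"
    using has_derivative_compose hessian by blast
  from has_derivative_inner_left[OF this, of u]
  show ?thesis
    by (simp add: has_field_derivative_def inner_commute mult.commute[of _ "_ \<bullet> _"]
        matrix_vector_mult_scaleR)
qed

lemma gradient_mvt:
  obtains \<tau> where "0 < \<tau>" "\<tau> < 1"
    "(G (a + v) - G a) \<bullet> u = u \<bullet> (H (a + \<tau> *\<^sub>R v) *v v)"
proof -
  obtain \<tau> where "0 < \<tau>" "\<tau> < 1"
    "G (a + 1 *\<^sub>R v) \<bullet> u - G (a + 0 *\<^sub>R v) \<bullet> u = (1 - 0) * (u \<bullet> (H (a + \<tau> *\<^sub>R v) *v v))"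
    using MVT2[of 0 1 "\<lambda>\<tau>. G (a + \<tau> *\<^sub>R v) \<bullet> u", OF _ segment_gradient_deriv] by auto
  then show ?thesis using that by (simp add: inner_diff_left)
qed

lemma second_order_taylor:
  obtains \<tau> where "0 < \<tau>" "\<tau> \<le> 1"
    "f (a + v) = f a + G a \<bullet> v + (v \<bullet> (H (a + \<tau> *\<^sub>R v) *v v)) / 2"
proof -
  define D where "D = (\<lambda>m :: nat. if m = 0 then (\<lambda>\<tau>. f (a + \<tau> *\<^sub>R v))
    else if m = 1 then (\<lambda>\<tau>. G (a + \<tau> *\<^sub>R v) \<bullet> v)
    else (\<lambda>\<tau>. v \<bullet> (H (a + \<tau> *\<^sub>R v) *v v)))"
  have "\<forall>m t. m < 2 \<and> 0 \<le> t \<and> t \<le> 1 \<longrightarrow> (D m has_real_derivative D (Suc m) t) (at t)"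
    using segment_deriv segment_gradient_deriv by (auto simp: D_def less_Suc_eq numeral_2_eq_2)
  from Maclaurin2[OF _ _ this, of "\<lambda>\<tau>. f (a + \<tau> *\<^sub>R v)"] obtain \<tau> where
    "0 < \<tau>" "\<tau> \<le> 1" "f (a + 1 *\<^sub>R v) = (\<Sum>m<2. D m 0 / fact m * 1 ^ m) + D 2 \<tau> / fact 2 * 1\<^sup>2"
    by (auto simp: D_def)
  then show ?thesis using that by (auto simp: D_def numeral_2_eq_2)
qed

lemma strongly_convex_gradient:
  "f y \<ge> f x + G x \<bullet> (y - x) + \<mu> / 2 * (norm (y - x))\<^sup>2"
proof -
  let ?phi = "\<lambda>u. f (x + u *\<^sub>R (y - x))"
  have "((\<lambda>u. (?phi u - f x) / u) \<longlongrightarrow> G x \<bullet> (y - x)) (at_right 0)"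
    using segment_deriv[of x "y - x" 0]
    by (auto simp: has_field_derivative_iff intro: tendsto_mono[OF at_within_le_at])
  moreover have "((\<lambda>u. f y - f x - \<mu> / 2 * (1 - u) * (norm (x - y))\<^sup>2)
      \<longlongrightarrow> f y - f x - \<mu> / 2 * (1 - 0) * (norm (x - y))\<^sup>2) (at_right 0)"
    by (intro tendsto_intros)
  moreover have "\<forall>\<^sub>F u in at_right 0. (?phi u - f x) / u \<le> f y - f x - \<mu> / 2 * (1 - u) * (norm (x - y))\<^sup>2"
    unfolding eventually_at_right_field
  proof (intro exI[of _ 1] conjI allI impI)
    fix u :: real assume u: "0 < u" "u < 1"
    have "(1 - u) *\<^sub>R x + u *\<^sub>R y = x + u *\<^sub>R (y - x)" by (simp add: algebra_simps)
    then have "?phi u \<le> (1 - u) * f x + u * f y - \<mu> / 2 * u * (1 - u) * (norm (x - y))\<^sup>2"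
      using strongly_convex u unfolding strongly_convex_def
      by (metis atLeastAtMost_iff less_imp_le)
    then have "?phi u - f x \<le> u * (f y - f x - \<mu> / 2 * (1 - u) * (norm (x - y))\<^sup>2)"
      by (simp add: algebra_simps)
    then show "(?phi u - f x) / u \<le> f y - f x - \<mu> / 2 * (1 - u) * (norm (x - y))\<^sup>2"
      using u by (simp add: divide_le_eq mult.commute)
  qed simp
  ultimately have "G x \<bullet> (y - x) \<le> f y - f x - \<mu> / 2 * (1 - 0) * (norm (x - y))\<^sup>2"
    by (intro tendsto_le[of "at_right 0"]) auto
  then show ?thesis by (simp add: norm_minus_commute)
qed

lemma gradient_strongly_monotone:
  "(G y - G x) \<bullet> (y - x) \<ge> \<mu> * (norm (y - x))\<^sup>2"
  using strongly_convex_gradient[of x y] strongly_convex_gradient[of y x]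
  by (simp add: inner_simps norm_minus_commute[of x y])

lemma hessian_bounds:
  shows hessian_lower: "\<mu> * (norm v)\<^sup>2 \<le> v \<bullet> (H z *v v)"
    and hessian_upper: "v \<bullet> (H z *v v) \<le> L * (norm v)\<^sup>2"
proof -
  let ?q = "\<lambda>\<tau>. (G (z + \<tau> *\<^sub>R v) \<bullet> v - G z \<bullet> v) / \<tau>"
  have lim: "(?q \<longlongrightarrow> v \<bullet> (H z *v v)) (at_right 0)"
    using segment_gradient_deriv[of z v v 0]
    by (auto simp: has_field_derivative_iff intro: tendsto_mono[OF at_within_le_at])
  have low: "\<mu> * (norm v)\<^sup>2 \<le> ?q \<tau>" if "\<tau> > 0" for \<tau>
  proof -
    have "\<mu> * (norm (\<tau> *\<^sub>R v))\<^sup>2 = \<tau> * (\<mu> * (norm v)\<^sup>2 * \<tau>)"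
      by (simp add: power_mult_distrib power2_eq_square)
    then have "\<tau> * (\<mu> * (norm v)\<^sup>2 * \<tau>) \<le> \<tau> * ((G (z + \<tau> *\<^sub>R v) - G z) \<bullet> v)"
      using gradient_strongly_monotone[of "z + \<tau> *\<^sub>R v" z]
      by (simp only: add_diff_cancel_left' inner_scaleR_right)
    then have "\<mu> * (norm v)\<^sup>2 * \<tau> \<le> (G (z + \<tau> *\<^sub>R v) - G z) \<bullet> v"
      using that by (rule mult_left_le_imp_le)
    then show ?thesis using that by (simp only: pos_le_divide_eq inner_diff_left)
  qed
  have up: "?q \<tau> \<le> L * (norm v)\<^sup>2" if "\<tau> > 0" for \<tau>
  proof -
    have "(G (z + \<tau> *\<^sub>R v) - G z) \<bullet> v \<le> norm (G (z + \<tau> *\<^sub>R v) - G z) * norm v"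
      by (rule norm_cauchy_schwarz)
    also have "\<dots> \<le> (L * norm (\<tau> *\<^sub>R v)) * norm v"
      using lipschitz_onD[OF lipschitz, of "z + \<tau> *\<^sub>R v" z]
      by (intro mult_right_mono) (auto simp: dist_norm)
    finally show ?thesis using that
      by (simp add: pos_divide_le_eq inner_diff_left power2_eq_square algebra_simps)
  qed
  show "\<mu> * (norm v)\<^sup>2 \<le> v \<bullet> (H z *v v)"
    by (rule tendsto_lowerbound[OF lim]) (auto simp: eventually_at_right_field low intro: exI[of _ 1])
  show "v \<bullet> (H z *v v) \<le> L * (norm v)\<^sup>2"
    by (rule tendsto_upperbound[OF lim]) (auto simp: eventually_at_right_field up intro: exI[of _ 1])
qed

lemma hessian_diff: "\<bar>u \<bullet> (H z *v v) - u \<bullet> (H w *v v)\<bar> \<le> M * norm (z - w) * norm u * norm v"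
proof -
  have "u \<bullet> (H z *v v) - u \<bullet> (H w *v v) = u \<bullet> ((H z - H w) *v v)"
    by (simp add: matrix_vector_mult_diff_rdistrib inner_diff_right)
  also have "\<bar>\<dots>\<bar> \<le> norm u * norm ((H z - H w) *v v)" by (rule Cauchy_Schwarz_ineq2)
  also have "\<dots> \<le> norm u * (onorm (\<lambda>h. (H z - H w) *v h) * norm v)"
    by (intro mult_left_mono onorm) (auto simp: matrix_vector_mul_bounded_linear)
  also have "\<dots> \<le> norm u * ((M * norm (z - w)) * norm v)"
    by (intro mult_left_mono mult_right_mono hessian_lipschitz) auto
  finally show ?thesis by (simp add: mult_ac)
qed

text \<open>
  Two applications of the mean value theorem express the second difference of \<open>f\<close> by the Hessian at a
  nearby point. The difference is symmetric in \<open>h\<close> and \<open>k\<close>, so letting \<open>t\<close> tend to zero yields the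
  symmetry of the Hessian.
\<close>

lemma second_difference:
  assumes "t > 0"
  obtains \<xi> where "norm (\<xi> - z) \<le> t * (norm h + norm k)"
    "f (z + t *\<^sub>R h + t *\<^sub>R k) - f (z + t *\<^sub>R h) - f (z + t *\<^sub>R k) + f z = t\<^sup>2 * (h \<bullet> (H \<xi> *v k))"
proof -
  let ?F = "\<lambda>a. f ((z + t *\<^sub>R k) + a *\<^sub>R h) - f (z + a *\<^sub>R h)"
  have "(?F has_real_derivative G ((z + t *\<^sub>R k) + a *\<^sub>R h) \<bullet> h - G (z + a *\<^sub>R h) \<bullet> h) (at a)" for a
    by (intro DERIV_diff segment_deriv)
  from MVT2[of 0 t ?F, OF assms this] obtain a where a: "0 < a" "a < t"
    "?F t - ?F 0 = (t - 0) * (G ((z + t *\<^sub>R k) + a *\<^sub>R h) \<bullet> h - G (z + a *\<^sub>R h) \<bullet> h)" by blast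
  obtain b where b: "0 < b" "b < 1"
    "(G (z + a *\<^sub>R h + t *\<^sub>R k) - G (z + a *\<^sub>R h)) \<bullet> h
      = h \<bullet> (H (z + a *\<^sub>R h + b *\<^sub>R (t *\<^sub>R k)) *v (t *\<^sub>R k))" using gradient_mvt by blast
  let ?xi = "z + a *\<^sub>R h + b *\<^sub>R (t *\<^sub>R k)"
  have "norm (?xi - z) \<le> norm (a *\<^sub>R h) + norm (b *\<^sub>R (t *\<^sub>R k))"
    using norm_triangle_ineq[of "a *\<^sub>R h" "b *\<^sub>R (t *\<^sub>R k)"] by (simp only: add.assoc add_diff_cancel_left')
  also have "\<dots> \<le> t * norm h + 1 * (t * norm k)"
    using a b assms by (auto intro!: add_mono mult_mono)
  finally have "norm (?xi - z) \<le> t * (norm h + norm k)" by (simp add: algebra_simps)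
  moreover have "f (z + t *\<^sub>R h + t *\<^sub>R k) - f (z + t *\<^sub>R h) - f (z + t *\<^sub>R k) + f z
    = t\<^sup>2 * (h \<bullet> (H ?xi *v k))"
  proof -
    have eqs: "z + t *\<^sub>R k + a *\<^sub>R h = z + a *\<^sub>R h + t *\<^sub>R k"
      "z + t *\<^sub>R k + t *\<^sub>R h = z + t *\<^sub>R h + t *\<^sub>R k" by (simp_all add: add_ac)
    have "?F t - ?F 0 = t * (h \<bullet> (H ?xi *v (t *\<^sub>R k)))"
      using a(3) b(3) unfolding eqs inner_diff_left by simp
    then show ?thesis
      unfolding eqs by (simp add: matrix_vector_mult_scaleR power2_eq_square)
  qed
  ultimately show ?thesis using that by blast
qed

lemma hessian_symmetric: "transpose (H z) = H z"
proof -
  have "h \<bullet> (H z *v k) = k \<bullet> (H z *v h)" for h k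
  proof (rule ccontr)
    assume ne: "h \<bullet> (H z *v k) \<noteq> k \<bullet> (H z *v h)"
    define e where "e = \<bar>h \<bullet> (H z *v k) - k \<bullet> (H z *v h)\<bar>"
    define K where "K = 2 * M * (norm h + norm k) * norm h * norm k"
    have e: "e > 0" and K: "K \<ge> 0" using ne M_pos by (auto simp: e_def K_def)
    have bound: "e \<le> t * K" if t: "t > 0" for t
    proof -
      obtain p where p: "norm (p - z) \<le> t * (norm h + norm k)"
        "f (z + t *\<^sub>R h + t *\<^sub>R k) - f (z + t *\<^sub>R h) - f (z + t *\<^sub>R k) + f z = t\<^sup>2 * (h \<bullet> (H p *v k))"
        using second_difference[OF t] by metis
      obtain q where q: "norm (q - z) \<le> t * (norm k + norm h)"
        "f (z + t *\<^sub>R k + t *\<^sub>R h) - f (z + t *\<^sub>R k) - f (z + t *\<^sub>R h) + f z = t\<^sup>2 * (k \<bullet> (H q *v h))"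
        using second_difference[OF t] by metis
      have "t\<^sup>2 * (h \<bullet> (H p *v k)) = t\<^sup>2 * (k \<bullet> (H q *v h))"
        using p(2) q(2) by (simp add: algebra_simps)
      then have eq: "h \<bullet> (H p *v k) = k \<bullet> (H q *v h)" using t by simp
      have "\<bar>h \<bullet> (H p *v k) - h \<bullet> (H z *v k)\<bar> \<le> M * (t * (norm h + norm k)) * norm h * norm k"
        by (rule order_trans[OF hessian_diff]) (intro mult_right_mono mult_left_mono p(1), use M_pos in auto)
      moreover have "\<bar>k \<bullet> (H q *v h) - k \<bullet> (H z *v h)\<bar> \<le> M * (t * (norm k + norm h)) * norm k * norm h"
        by (rule order_trans[OF hessian_diff]) (intro mult_right_mono mult_left_mono q(1), use M_pos in auto)
      ultimately have "e \<le> M * (t * (norm h + norm k)) * norm h * norm k + M * (t * (norm k + norm h)) * norm k * norm h"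
        unfolding e_def using eq by linarith
      then show ?thesis by (simp add: K_def algebra_simps)
    qed
    \<comment> \<open>A step so short that the bound contradicts \<open>e > 0\<close>; the additional 1 covers \<open>K = 0\<close>.\<close>
    have "e \<le> e / (2 * (K + 1)) * K" using e K by (intro bound) auto
    also have "\<dots> < e" using e K by (simp add: divide_simps)
    finally show False by simp
  qed
  then have "(transpose (H z) *v h) \<bullet> k = (H z *v h) \<bullet> k" for h k
    by (metis dot_lmul_matrix inner_commute transpose_matrix_vector)
  then have "transpose (H z) *v h = H z *v h" for h
    using vector_eq_rdot by blast
  then show ?thesis by (simp add: matrix_eq)
qed

lemma hessian_spd: "spd (H z)"
  unfolding spd_def
proof (intro conjI allI impI hessian_symmetric)
  fix v :: "real^'n" assume "v \<noteq> 0"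
  then have "0 < \<mu> * (norm v)\<^sup>2" using mu_pos by simp
  then show "0 < v \<bullet> (H z *v v)" using hessian_lower[of v z] by linarith
qed

lemma gradient_minimizer: "G x_star = 0"
proof -
  have "((\<lambda>\<tau>. f (x_star + \<tau> *\<^sub>R G x_star)) has_real_derivative G x_star \<bullet> G x_star) (at 0)"
    using segment_deriv[of x_star "G x_star" 0] by simp
  then have "G x_star \<bullet> G x_star = 0"
    by (rule DERIV_local_min[where d = 1]) (auto simp: minimizer)
  then show ?thesis by simp
qed

definition gap :: "real^'n \<Rightarrow> real" where
  "gap z = f z - f x_star"

text \<open>
  Strong convexity bounds the distance to the minimizer by the gap, so \<open>C z\<close> bounds the relative change
  of the Hessian between \<open>z\<close>, or any point with a smaller value, and the minimizer.
\<close>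

definition C :: "real^'n \<Rightarrow> real" where
  "C z = M / (\<mu> powr (3 / 2)) * sqrt (2 * gap z)"

lemma gap_nonneg: "gap z \<ge> 0"
  using minimizer by (simp add: gap_def)

lemma gap_lower: "\<mu> / 2 * (norm (z - x_star))\<^sup>2 \<le> gap z"
  using strongly_convex_gradient[of x_star z] by (simp add: gradient_minimizer gap_def)

lemma gap_pos: "G z \<noteq> 0 \<Longrightarrow> gap z > 0"
proof -
  assume "G z \<noteq> 0"
  then have "z \<noteq> x_star" using gradient_minimizer by auto
  then have "0 < \<mu> / 2 * (norm (z - x_star))\<^sup>2" using mu_pos by simp
  then show ?thesis using gap_lower[of z] by linarith
qed

lemma gap_le_gradient: "2 * \<mu> * gap z \<le> (norm (G z))\<^sup>2"
proof -
  let ?d = "x_star - z"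
  have "0 \<le> (norm (G z + \<mu> *\<^sub>R ?d))\<^sup>2" by simp
  also have "\<dots> = (norm (G z))\<^sup>2 + 2 * \<mu> * (G z \<bullet> ?d) + \<mu>\<^sup>2 * (norm ?d)\<^sup>2"
    unfolding power2_norm_eq_inner by (simp add: inner_simps power2_eq_square algebra_simps inner_commute)
  also have "\<dots> = (norm (G z))\<^sup>2 + 2 * \<mu> * (G z \<bullet> ?d + \<mu> / 2 * (norm ?d)\<^sup>2)"
    by (simp add: power2_eq_square algebra_simps)
  also have "\<dots> \<le> (norm (G z))\<^sup>2 + 2 * \<mu> * (- gap z)"
    using strongly_convex_gradient[of z x_star] mu_pos by (simp add: gap_def)
  finally show ?thesis by simp
qed

lemma mu_powr: "\<mu> powr (3 / 2) = \<mu> * sqrt \<mu>"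
proof -
  have "\<mu> powr (3 / 2) = \<mu> powr (1 + 1 / 2)" by simp
  also have "\<dots> = \<mu> * sqrt \<mu>" using mu_pos by (subst powr_add) (simp add: powr_half_sqrt)
  finally show ?thesis .
qed

lemma C_nonneg: "C z \<ge> 0"
  using M_pos mu_pos gap_nonneg by (simp add: C_def)

lemma C_mono: "f z \<le> f w \<Longrightarrow> C z \<le> C w"
  unfolding C_def using M_pos mu_pos by (intro mult_left_mono) (auto simp: gap_def)

lemma distance_le_C: "M * norm (z - x_star) / \<mu> \<le> C z"
proof -
  have "(norm (z - x_star))\<^sup>2 \<le> 2 * gap z / \<mu>"
    using gap_lower[of z] mu_pos by (simp add: pos_le_divide_eq algebra_simps)
  then have "norm (z - x_star) \<le> sqrt (2 * gap z / \<mu>)" by (rule real_le_rsqrt)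
  then have "M / \<mu> * norm (z - x_star) \<le> M / \<mu> * sqrt (2 * gap z / \<mu>)"
    using M_pos mu_pos by (intro mult_left_mono) auto
  also have "\<dots> = C z" by (simp add: C_def mu_powr real_sqrt_divide)
  finally show ?thesis by simp
qed

text \<open>
  The change of the Hessian is at most \<open>M\<close> times the distance, hence at most \<open>c \<mu>\<close> in norm, and \<open>\<mu>\<close>
  times the identity is below either of the two Hessians.
\<close>

lemma hessian_comparison:
  assumes "M * norm (z - x_star) / \<mu> \<le> c"
  shows hessian_le_optimal: "v \<bullet> (H z *v v) \<le> (1 + c) * (v \<bullet> (H x_star *v v))"
    and optimal_le_hessian: "v \<bullet> (H x_star *v v) \<le> (1 + c) * (v \<bullet> (H z *v v))"
proof -
  have c: "M * norm (z - x_star) \<le> c * \<mu>" using assms mu_pos by (simp add: divide_le_eq)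
  have c0: "c \<ge> 0" using assms M_pos mu_pos by (smt (verit) divide_nonneg_pos mult_nonneg_nonneg norm_ge_zero)
  have "\<bar>v \<bullet> (H z *v v) - v \<bullet> (H x_star *v v)\<bar> \<le> M * norm (z - x_star) * (norm v)\<^sup>2"
    using hessian_diff[of v z v x_star] by (simp add: power2_eq_square mult.assoc)
  also have "\<dots> \<le> c * \<mu> * (norm v)\<^sup>2" by (intro mult_right_mono c) simp
  finally have d: "\<bar>v \<bullet> (H z *v v) - v \<bullet> (H x_star *v v)\<bar> \<le> c * (\<mu> * (norm v)\<^sup>2)" by (simp add: mult.assoc)
  have low: "c * (\<mu> * (norm v)\<^sup>2) \<le> c * (v \<bullet> (H w *v v))" for w
    by (intro mult_left_mono hessian_lower c0)
  show "v \<bullet> (H z *v v) \<le> (1 + c) * (v \<bullet> (H x_star *v v))"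
    using d low[of x_star] by (simp add: algebra_simps)
  show "v \<bullet> (H x_star *v v) \<le> (1 + c) * (v \<bullet> (H z *v v))"
    using d low[of z] by (simp add: algebra_simps)
qed

text \<open>
  This is the inequality \<open>J P\<^sup>-\<^sup>1 J \<le> K J\<close> for the averaged Hessian \<open>J\<close> on the segment, applied to \<open>s\<close>,
  obtained without integrals. The mean value theorem for the single scalar function
  \<open>G \<bullet> ((2 / K) u - s)\<close> along the segment, with \<open>u = P\<^sup>-\<^sup>1 y\<close>, reduces it to the nonnegativity of the
  Hessian form at \<open>s - u / K\<close> for one intermediate point.
\<close>

lemma secant_weighted_bound:
  assumes P: "spd P" and K: "K > 0"
    and le: "\<And>\<tau> u. 0 \<le> \<tau> \<Longrightarrow> \<tau> \<le> 1 \<Longrightarrow> u \<bullet> (H (a + \<tau> *\<^sub>R s) *v u) \<le> K * (u \<bullet> (P *v u))"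
  defines "y \<equiv> G (a + s) - G a"
  shows "y \<bullet> (matrix_inv P *v y) \<le> K * (s \<bullet> y)"
proof -
  define u where "u = matrix_inv P *v y"
  have Pu: "P *v u = y"
    unfolding u_def by (rule mult_matrix_inv_vector[OF P])
  obtain \<tau> where \<tau>: "0 < \<tau>" "\<tau> < 1" "y \<bullet> ((2 / K) *\<^sub>R u - s) = ((2 / K) *\<^sub>R u - s) \<bullet> (H (a + \<tau> *\<^sub>R s) *v s)"
    unfolding y_def using gradient_mvt by blast
  let ?H = "H (a + \<tau> *\<^sub>R s)"
  have "0 \<le> (s - (1 / K) *\<^sub>R u) \<bullet> (?H *v (s - (1 / K) *\<^sub>R u))"
    by (rule spd_nonneg[OF hessian_spd])
  also have "\<dots> = (1 / K)\<^sup>2 * (u \<bullet> (?H *v u)) - ((2 / K) *\<^sub>R u - s) \<bullet> (?H *v s)"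
    using inner_matrix_vector_symmetric[OF hessian_symmetric, of s _ u]
    by (simp add: algebra_simps inner_simps power2_eq_square)
  also have "\<dots> \<le> (1 / K)\<^sup>2 * (K * (u \<bullet> (P *v u))) - y \<bullet> ((2 / K) *\<^sub>R u - s)"
    unfolding \<tau>(3) using le[of \<tau> u] \<tau> by (intro diff_right_mono mult_left_mono) auto
  also have "\<dots> = s \<bullet> y - (y \<bullet> u) / K"
    using K unfolding Pu by (simp add: inner_simps power2_eq_square inner_commute field_simps)
  finally have "(y \<bullet> u) / K \<le> s \<bullet> y" by simp
  then show ?thesis using K by (simp add: u_def divide_le_eq mult.commute)
qed

lemma sublevel_segment:
  assumes "f (a + s) \<le> f a" "0 \<le> \<tau>" "\<tau> \<le> 1"
  shows "f (a + \<tau> *\<^sub>R s) \<le> f a"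
proof -
  have "(1 - \<tau>) *\<^sub>R a + \<tau> *\<^sub>R (a + s) = a + \<tau> *\<^sub>R s" by (simp add: algebra_simps)
  then have "f (a + \<tau> *\<^sub>R s) \<le> (1 - \<tau>) * f a + \<tau> * f (a + s) - \<mu> / 2 * \<tau> * (1 - \<tau>) * (norm (a - (a + s)))\<^sup>2"
    using strongly_convex assms(2,3) unfolding strongly_convex_def
    by (metis atLeastAtMost_iff)
  also have "\<dots> \<le> (1 - \<tau>) * f a + \<tau> * f (a + s)" using assms mu_pos by simp
  also have "\<dots> \<le> (1 - \<tau>) * f a + \<tau> * f a" using assms by (intro add_left_mono mult_left_mono) auto
  finally show ?thesis by (simp add: algebra_simps)
qed

text \<open>
  A descent step stays in the sublevel set, which is convex. This is why all bounds along a step can be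
  stated with \<open>C\<close> at its starting point.
\<close>

lemma descent_segment_distance:
  assumes "f (a + s) \<le> f a" "0 \<le> \<tau>" "\<tau> \<le> 1"
  shows "M * norm (a + \<tau> *\<^sub>R s - x_star) / \<mu> \<le> C a"
  using distance_le_C[of "a + \<tau> *\<^sub>R s"] C_mono[OF sublevel_segment[OF assms]] by linarith

lemma secant_optimal_bound:
  assumes "f (a + s) \<le> f a"
  defines "y \<equiv> G (a + s) - G a"
  shows "y \<bullet> (matrix_inv (H x_star) *v y) \<le> (1 + C a) * (s \<bullet> y)"
  unfolding y_def using C_nonneg[of a]
  by (intro secant_weighted_bound hessian_spd hessian_le_optimal descent_segment_distance assms) auto

lemma secant_curvature_bound:
  assumes "f (a + s) \<le> f a"
  defines "y \<equiv> G (a + s) - G a"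
  shows "s \<bullet> (H x_star *v s) \<le> (1 + C a) * (s \<bullet> y)"
proof -
  obtain \<tau> where "0 < \<tau>" "\<tau> < 1" "y \<bullet> s = s \<bullet> (H (a + \<tau> *\<^sub>R s) *v s)"
    unfolding y_def using gradient_mvt by blast
  then show ?thesis
    using optimal_le_hessian[OF descent_segment_distance[OF assms(1), of \<tau>], of s]
    by (simp add: inner_commute)
qed

text \<open>
  By Taylor's formula from \<open>z\<close> to the minimizer, the value there is at least that of a quadratic model
  with Hessian \<open>P / c\<close>; minimizing the model over all displacements gives the bound.
\<close>

lemma gap_le_weighted_gradient:
  "2 * gap z \<le> (1 + C z) * (G z \<bullet> (matrix_inv (H x_star) *v G z))"
proof -
  define P where "P = H x_star"
  define e where "e = x_star - z"
  define u where "u = matrix_inv P *v G z"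
  have P: "spd P" by (simp add: P_def hessian_spd)
  have Pu: "P *v u = G z"
    unfolding u_def by (rule mult_matrix_inv_vector[OF P])
  define c where "c = 1 + C z"
  have c: "c > 0" using C_nonneg[of z] by (simp add: c_def)
  obtain \<tau> where \<tau>: "0 < \<tau>" "\<tau> \<le> 1"
    "f (z + e) = f z + G z \<bullet> e + (e \<bullet> (H (z + \<tau> *\<^sub>R e) *v e)) / 2"
    using second_order_taylor by blast
  have "f (z + e) \<le> f z" using minimizer by (simp add: e_def)
  from optimal_le_hessian[OF descent_segment_distance[OF this, of \<tau>], of e]
  have "(e \<bullet> (P *v e)) / c \<le> e \<bullet> (H (z + \<tau> *\<^sub>R e) *v e)"
    using \<tau> c by (simp add: divide_le_eq mult.commute c_def P_def)
  then have "2 * gap z \<le> - 2 * (G z \<bullet> e) - (e \<bullet> (P *v e)) / c"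
    using \<tau>(3) by (simp add: gap_def e_def)
  also have "\<dots> \<le> c * (G z \<bullet> u)"
  proof -
    have "0 \<le> (c *\<^sub>R u + e) \<bullet> (P *v (c *\<^sub>R u + e))" by (rule spd_nonneg[OF P])
    also have "\<dots> = c\<^sup>2 * (G z \<bullet> u) + 2 * c * (G z \<bullet> e) + e \<bullet> (P *v e)"
      using inner_matrix_vector_symmetric[OF spd_transpose[OF P], of u e] Pu
      by (simp add: algebra_simps inner_simps power2_eq_square inner_commute)
    finally have "0 \<le> (c\<^sup>2 * (G z \<bullet> u) + 2 * c * (G z \<bullet> e) + e \<bullet> (P *v e)) / c" using c by simp
    also have "\<dots> = c * (G z \<bullet> u) + 2 * (G z \<bullet> e) + (e \<bullet> (P *v e)) / c"
      using c by (simp add: field_simps power2_eq_square)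
    finally show ?thesis by simp
  qed
  finally show ?thesis by (simp add: c_def u_def P_def)
qed

text \<open>
  Cocoercivity of the gradient between \<open>z\<close> and the minimizer, combined with the Cauchy-Schwarz
  inequality for \<open>P\<close>. The exponent is not optimal; \<open>unit_step_descends\<close> only needs some constant.
\<close>

lemma weighted_gradient_le_gap:
  "G z \<bullet> (matrix_inv (H x_star) *v G z) \<le> 2 * (1 + C z) ^ 3 * gap z"
proof -
  define P where "P = H x_star"
  define e where "e = x_star - z"
  define g where "g = G z \<bullet> (matrix_inv P *v G z)"
  define c where "c = 1 + C z"
  have P: "spd P" by (simp add: P_def hessian_spd)
  have c: "c > 0" using C_nonneg[of z] by (simp add: c_def)
  have desc: "f (z + e) \<le> f z" using minimizer by (simp add: e_def)
  have ze: "G (z + e) = 0" by (simp add: e_def gradient_minimizer)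
  have g1: "g \<le> c * - (G z \<bullet> e)"
  proof -
    have "matrix_inv P *v - G z = - (matrix_inv P *v G z)"
      using matrix_vector_mult_diff_distrib[of "matrix_inv P" 0 "G z"] by simp
    then show ?thesis
      using secant_optimal_bound[OF desc] by (simp add: ze g_def c_def P_def inner_commute)
  qed
  obtain \<tau> where \<tau>: "0 < \<tau>" "\<tau> \<le> 1"
    "f (x_star - e) = f x_star + G x_star \<bullet> - e + (- e \<bullet> (H (x_star + \<tau> *\<^sub>R - e) *v - e)) / 2"
    using second_order_taylor[of x_star "- e"] by auto
  have 1: "x_star + \<tau> *\<^sub>R - e = z + (1 - \<tau>) *\<^sub>R e" by (simp add: e_def algebra_simps)
  have 2: "H w *v - e = - (H w *v e)" for w
    using matrix_vector_mult_diff_distrib[of "H w" 0 e] by simp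
  have 3: "x_star - e = z" by (simp add: e_def)
  have "gap z = (e \<bullet> (H (z + (1 - \<tau>) *\<^sub>R e) *v e)) / 2"
    using \<tau>(3) unfolding 1 2 3 by (simp add: gradient_minimizer gap_def)
  then have gap: "e \<bullet> (H (z + (1 - \<tau>) *\<^sub>R e) *v e) = 2 * gap z" by simp
  have "e \<bullet> (P *v e) \<le> c * (e \<bullet> (H (z + (1 - \<tau>) *\<^sub>R e) *v e))"
    unfolding P_def c_def using \<tau> by (intro optimal_le_hessian descent_segment_distance desc) auto
  then have e2: "e \<bullet> (P *v e) \<le> 2 * c * gap z" unfolding gap by simp
  let ?u = "matrix_inv P *v G z"
  have Pu: "P *v ?u = G z"
    by (rule mult_matrix_inv_vector[OF P])
  have cs: "(G z \<bullet> e)\<^sup>2 \<le> g * (e \<bullet> (P *v e))"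
    using spd_cauchy_schwarz[OF P, of e ?u] unfolding Pu g_def by (simp add: inner_commute mult.commute)
  have g0: "g \<ge> 0" unfolding g_def by (rule spd_nonneg[OF spd_matrix_inv[OF P]])
  have "g\<^sup>2 \<le> (c * - (G z \<bullet> e))\<^sup>2" using g0 g1 by (intro power_mono) auto
  also have "\<dots> = c\<^sup>2 * (G z \<bullet> e)\<^sup>2" by (simp add: power_mult_distrib)
  also have "\<dots> \<le> c\<^sup>2 * (g * (2 * c * gap z))"
    by (intro mult_left_mono order_trans[OF cs] e2 g0) auto
  finally have "g * g \<le> g * (2 * c ^ 3 * gap z)" by (simp add: power2_eq_square power3_eq_cube mult_ac)
  then have "g \<le> 2 * c ^ 3 * gap z"
    using g0 c gap_nonneg[of z] by (cases "g = 0") (auto simp: mult_le_cancel_left)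
  then show ?thesis by (simp add: g_def c_def P_def)
qed

end

section \<open>The function omega\<close>

lemma ln_ge_one_minus_inverse: "z > 0 \<Longrightarrow> 1 - 1 / z \<le> ln (z :: real)"
  using ln_le_minus_one[of "1 / z"] by (simp add: ln_div)

lemma ln_le_pade:
  fixes r :: real
  assumes "0 < r" "r \<le> 1"
  shows "ln r \<le> 2 * (r - 1) / (r + 1)"
proof -
  have "(\<lambda>y. ln y - 2 * (y - 1) / (y + 1)) r \<le> (\<lambda>y. ln y - 2 * (y - 1) / (y + 1)) 1"
  proof (rule DERIV_nonneg_imp_nondecreasing[OF assms(2)])
    fix y :: real assume y: "r \<le> y" "y \<le> 1"
    then have y0: "y > 0" using assms by simp
    have "((\<lambda>y. ln y - 2 * (y - 1) / (y + 1)) has_real_derivative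
      (1 / y - (2 * (y + 1) - 2 * (y - 1)) / ((y + 1) * (y + 1)))) (at y)"
      using y0 by (auto intro!: derivative_eq_intros)
    moreover have "1 / y - (2 * (y + 1) - 2 * (y - 1)) / ((y + 1) * (y + 1)) = (y - 1)\<^sup>2 / (y * (y + 1)\<^sup>2)"
      using y0 by (simp add: divide_simps power2_eq_square) (simp add: algebra_simps)
    ultimately show "\<exists>D. ((\<lambda>y. ln y - 2 * (y - 1) / (y + 1)) has_real_derivative D) (at y) \<and> 0 \<le> D"
      using y0 by (intro exI[of _ "(y - 1)\<^sup>2 / (y * (y + 1)\<^sup>2)"]) simp
  qed
  then show ?thesis by simp
qed

lemma ln_le_half_diff_inverse:
  fixes r :: real
  assumes "1 \<le> r"
  shows "ln r \<le> (r - 1 / r) / 2"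
proof -
  have "(\<lambda>y. (y - 1 / y) / 2 - ln y) 1 \<le> (\<lambda>y. (y - 1 / y) / 2 - ln y) r"
  proof (rule DERIV_nonneg_imp_nondecreasing[OF assms])
    fix y :: real assume y: "1 \<le> y" "y \<le> r"
    have "((\<lambda>y. (y - 1 / y) / 2 - ln y) has_real_derivative ((1 + 1 / y\<^sup>2) / 2 - 1 / y)) (at y)"
      using y by (auto intro!: derivative_eq_intros simp: power2_eq_square)
    moreover have "(1 + 1 / y\<^sup>2) / 2 - 1 / y = (1 - 1 / y)\<^sup>2 / 2"
      by (simp add: power2_eq_square algebra_simps divide_simps)
    ultimately show "\<exists>D. ((\<lambda>y. (y - 1 / y) / 2 - ln y) has_real_derivative D) (at y) \<and> 0 \<le> D"
      by (metis zero_le_power2 zero_le_divide_iff zero_le_numeral)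
  qed
  then show ?thesis by simp
qed

lemma omega_shift: "omega (r - 1) = r - 1 - ln r"
  by (simp add: omega_def)

lemma omega_nonneg: "r > 0 \<Longrightarrow> omega (r - 1) \<ge> 0"
  using ln_le_minus_one[of r] by (simp add: omega_shift)

lemma omega_le: 
  assumes "r > 0" shows "omega (r - 1) \<le> (r - 1)\<^sup>2 / r"
proof -
  have "omega (r - 1) \<le> r - 1 - (1 - 1 / r)"
    using ln_ge_one_minus_inverse[OF assms] by (simp add: omega_shift)
  also have "\<dots> = (r - 1)\<^sup>2 / r" using assms by (simp add: power2_eq_square field_simps)
  finally show ?thesis .
qed

lemma omega_pos:
  assumes "r > 0" "r \<noteq> 1" shows "omega (r - 1) > 0"
proof -
  have "ln r \<noteq> r - 1" using assms ln_eq_minus_one by blast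
  then show ?thesis using ln_le_minus_one[OF assms(1)] by (simp add: omega_shift)
qed

lemma omega_antimono:
  assumes "0 < p" "p \<le> q" "q \<le> 1" shows "omega (q - 1) \<le> omega (p - 1)"
proof -
  have "q - p \<le> 1 - 1 / (q / p)"
  proof -
    have "(q - p) * q \<le> (q - p) * 1" using assms by (intro mult_left_mono) auto
    then have "q - p \<le> (q - p) / q" using assms by (simp add: pos_le_divide_eq)
    also have "\<dots> = 1 - 1 / (q / p)" using assms by (simp add: field_simps)
    finally show ?thesis .
  qed
  also have "\<dots> \<le> ln (q / p)" using assms by (intro ln_ge_one_minus_inverse) auto
  finally show ?thesis using assms by (simp add: omega_shift ln_div)
qed

lemma omega_mono:
  assumes "1 \<le> p" "p \<le> q" shows "omega (p - 1) \<le> omega (q - 1)"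
proof -
  have "ln (q / p) \<le> q / p - 1" using assms by (intro ln_le_minus_one) auto
  also have "\<dots> = (q - p) / p" using assms by (simp add: field_simps)
  also have "\<dots> \<le> (q - p) / 1" using assms by (intro divide_left_mono) auto
  finally show ?thesis using assms by (simp add: omega_shift ln_div)
qed

text \<open>
  Both sides vanish to second order at \<open>r = 1\<close>, so the comparison needs bounds on \<open>ln\<close> that are exact to
  second order there: the Pade approximation below 1 and \<open>(r - 1 / r) / 2\<close> above 1.
\<close>

lemma ln_times_le_omega:
  fixes r :: real
  assumes "r > 0" shows "2 * (r - 1) * ln r \<le> max (2 + 2 / r) (4 * r) * omega (r - 1)"
proof (cases "r \<le> 1")
  case True
  have "ln r * (r + 1) \<le> 2 * (r - 1)" using ln_le_pade[OF assms True] assms by (simp add: pos_le_divide_eq)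
  then have "(1 - r) * (1 - r) \<le> (1 + r) * omega (r - 1)" by (simp add: omega_shift algebra_simps)
  then have "2 / r * ((1 - r) * (1 - r)) \<le> 2 / r * ((1 + r) * omega (r - 1))"
    using assms by (intro mult_left_mono) auto
  moreover have "2 * (1 - r) * (1 / r - 1) = 2 / r * ((1 - r) * (1 - r))"
    using assms by (simp add: field_simps)
  moreover have "(2 + 2 / r) * omega (r - 1) = 2 / r * ((1 + r) * omega (r - 1))"
    using assms by (simp add: field_simps)
  ultimately have *: "2 * (1 - r) * (1 / r - 1) \<le> (2 + 2 / r) * omega (r - 1)" by (simp only:)
  have "(1 - r) * (- ln r) \<le> (1 - r) * (1 / r - 1)"
    using True assms ln_ge_one_minus_inverse[OF assms] by (intro mult_left_mono) auto
  then have "2 * ((1 - r) * (- ln r)) \<le> 2 * ((1 - r) * (1 / r - 1))" by (rule mult_left_mono) simp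
  moreover have "2 * ((1 - r) * (- ln r)) = 2 * (r - 1) * ln r" by (simp add: algebra_simps)
  ultimately have "2 * (r - 1) * ln r \<le> 2 * (1 - r) * (1 / r - 1)" by (simp only: mult.assoc)
  also note *
  also have "(2 + 2 / r) * omega (r - 1) \<le> max (2 + 2 / r) (4 * r) * omega (r - 1)"
    by (intro mult_right_mono omega_nonneg assms) simp
  finally show ?thesis .
next
  case False
  then have r: "r \<ge> 1" by simp
  have "2 * r * ln r \<le> r * r - 1" using ln_le_half_diff_inverse[OF r] r by (simp add: field_simps)
  then have *: "(r - 1) * (r - 1) \<le> 2 * r * omega (r - 1)" by (simp add: omega_shift algebra_simps)
  have "(r - 1) * ln r \<le> (r - 1) * (r - 1)"
    using r ln_le_minus_one[OF assms] by (intro mult_left_mono) auto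
  then have "2 * (r - 1) * ln r \<le> (4 * r) * omega (r - 1)" using * by (simp add: algebra_simps)
  also have "\<dots> \<le> max (2 + 2 / r) (4 * r) * omega (r - 1)"
    by (intro mult_right_mono omega_nonneg assms) simp
  finally show ?thesis .
qed

section \<open>The constants of the line search\<close>

locale line_search_parameters =
  fixes \<alpha> \<beta> :: real
  assumes alpha_pos: "0 < \<alpha>" and alpha_less_beta: "\<alpha> < \<beta>" and beta_less_one: "\<beta> < 1"
    and alpha_less_half: "\<alpha> < 1 / 2"
begin

abbreviation "d1 \<equiv> \<delta>1 \<alpha> \<beta>"
abbreviation "d2 \<equiv> \<delta>2 \<alpha>"
abbreviation "d3 \<equiv> \<delta>3 \<beta>"
abbreviation "d4 \<equiv> \<delta>4 \<alpha> \<beta>"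
abbreviation "d5 \<equiv> \<delta>5 \<alpha> \<beta>"
abbreviation "d6 \<equiv> \<delta>6 \<alpha> \<beta>"
abbreviation "d7 \<equiv> \<delta>7 \<alpha> \<beta>"
abbreviation "d8 \<equiv> \<delta>8 \<alpha> \<beta>"

lemma sqrt_alpha: "sqrt (2 * (1 - \<alpha>)) > 1"
  using alpha_less_half by (simp add: real_less_rsqrt)

lemma d3_gt_one: "d3 > 1"
proof -
  have "sqrt (1 - \<beta>) < 1" using alpha_pos alpha_less_beta by simp
  then show ?thesis using beta_less_one by (simp add: \<delta>3_def)
qed

lemma d2_bounds: "7 / 8 \<le> d2" "1 / sqrt (2 * (1 - \<alpha>)) \<le> d2" "d2 < 1"
  using sqrt_alpha by (auto simp: \<delta>2_def)

lemma d1_bounds: "0 < d1" "d1 \<le> 1 / 6" "1 + d1 \<le> sqrt (2 * (1 - \<alpha>))" "1 + d1 \<le> d3"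
proof -
  let ?m = "min (sqrt (2 * (1 - \<alpha>)) - 1) (d3 - 1)"
  have d1: "d1 = min (1 / 6) ?m" by (simp only: \<delta>1_def \<delta>3_def)
  have m: "?m > 0" "?m \<le> sqrt (2 * (1 - \<alpha>)) - 1" "?m \<le> d3 - 1" using sqrt_alpha d3_gt_one by auto
  show "0 < d1" using m(1) unfolding d1 by linarith
  have "d1 \<le> ?m" unfolding d1 by (rule min.cobounded2)
  then show "1 + d1 \<le> sqrt (2 * (1 - \<alpha>))" "1 + d1 \<le> d3" using m by linarith+
  show "d1 \<le> 1 / 6" unfolding d1 by (rule min.cobounded1)
qed

lemma alpha_beta_quarter: "\<alpha> * (1 - \<beta>) \<le> 1 / 4" "0 < \<alpha> * (1 - \<beta>)"
proof -
  have "\<alpha> * (1 - \<beta>) \<le> \<alpha> * (1 - \<alpha>)" using alpha_pos alpha_less_beta by (intro mult_left_mono) auto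
  also have "\<dots> = 1 / 4 - (\<alpha> - 1 / 2)\<^sup>2" by (simp add: power2_eq_square field_simps)
  also have "\<dots> \<le> 1 / 4" by simp
  finally show "\<alpha> * (1 - \<beta>) \<le> 1 / 4" .
  show "0 < \<alpha> * (1 - \<beta>)" using alpha_pos beta_less_one by simp
qed

lemma d6_eq: "d6 = - ln (2 * (\<alpha> * (1 - \<beta>)))"
proof -
  have "1 / (2 * \<alpha> * (1 - \<beta>)) = inverse (2 * (\<alpha> * (1 - \<beta>)))"
    by (simp add: inverse_eq_divide mult.assoc)
  then show ?thesis unfolding \<delta>6_def using alpha_beta_quarter(2) by (simp only: ln_inverse)
qed

lemma d6_nonneg: "d6 \<ge> 0"
  unfolding d6_eq using alpha_beta_quarter by simp

lemma denominator_pos: "2 * d2 - 1 - d1 > 0"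
  using d1_bounds(2) d2_bounds(1) by simp

lemma d5_nonneg: "d5 \<ge> 0"
  unfolding \<delta>5_def using denominator_pos d3_gt_one by (intro divide_nonneg_pos) auto

lemma min_omega_pos: "min (omega (d2 - 1)) (omega (d3 - 1)) > 0"
  using d2_bounds d3_gt_one by (auto intro!: omega_pos)

lemma d4_pos: "d4 > 0"
  unfolding \<delta>4_def using min_omega_pos by simp

lemma d8_eq: "d8 = 3 + 2 * (d4 * d6) + 2 * d5 + (1 + (1 - ln d2) / (2 * d2 - 1 - d1))"
proof -
  have "(2 * d2 - d1 - ln d2) / (2 * d2 - 1 - d1)
    = ((2 * d2 - 1 - d1) + (1 - ln d2)) / (2 * d2 - 1 - d1)" by simp
  also have "\<dots> = 1 + (1 - ln d2) / (2 * d2 - 1 - d1)"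
    using denominator_pos by (subst add_divide_distrib) simp
  finally show ?thesis by (simp add: \<delta>8_def \<delta>7_def)
qed

lemma ln_d2_nonpos: "ln d2 \<le> 0"
  using d2_bounds by simp

lemma d8_ge: "d8 \<ge> 2 * (d4 * d6)" "d8 \<ge> 0"
proof -
  have "(1 - ln d2) / (2 * d2 - 1 - d1) \<ge> 0"
    using denominator_pos ln_d2_nonpos by (intro divide_nonneg_pos) auto
  then show "d8 \<ge> 2 * (d4 * d6)" unfolding d8_eq using d5_nonneg by simp
  then show "d8 \<ge> 0" using d4_pos d6_nonneg by (smt (verit) mult_nonneg_nonneg)
qed

text \<open>
  Since \<open>omega\<close> is quadratic near 0, its values at the ends \<open>\<delta>2 - 1\<close> and \<open>\<delta>3 - 1\<close> of the good interval
  are small compared with the distances of these ends from 0, and one of these distances is comparable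
  with \<open>\<delta>1\<close> unless \<open>\<delta>1 = 1 / 6\<close>. The constant 7 is the value of \<open>(1 + \<delta>1) / \<delta>1\<close> at \<open>\<delta>1 = 1 / 6\<close>.
\<close>

lemma seven_le_d4_d1: "7 \<le> d4 * d1"
proof -
  have "min (omega (d2 - 1)) (omega (d3 - 1)) \<le> d1 / 7"
  proof -
    let ?a = "sqrt (2 * (1 - \<alpha>))"
    have d2: "omega (d2 - 1) \<le> (1 - d2)\<^sup>2 / d2"
      using omega_le[of d2] d2_bounds by (simp add: power2_commute)
    have d3: "omega (d3 - 1) \<le> (d3 - 1)\<^sup>2 / d3" using omega_le[of d3] d3_gt_one by simp
    have small: "c\<^sup>2 / (1 + c) \<le> c / 7" if "0 < c" "c \<le> 1 / 6" for c :: real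
    proof -
      have "7 * c * c \<le> c * (1 + c)" using that mult_left_mono[of "6 * c" 1 c] by (simp add: algebra_simps)
      then show ?thesis using that by (simp add: divide_simps power2_eq_square)
    qed
    consider "d1 = 1 / 6" | "d1 = ?a - 1" | "d1 = d3 - 1" unfolding \<delta>1_def \<delta>3_def min_def by meson
    then show ?thesis
    proof cases
      case 1
      have "(1 - d2)\<^sup>2 \<le> (1 / 8)\<^sup>2" using d2_bounds by (intro power_mono) auto
      then have "(1 - d2)\<^sup>2 / d2 \<le> (1 / 8)\<^sup>2 / (7 / 8)" using d2_bounds by (intro frac_le) auto
      then show ?thesis using d2 1 by (simp add: power2_eq_square)
    next
      case 2
      have a: "?a = 1 + d1" using 2 by simp
      have inv: "1 - 1 / ?a = d1 / (1 + d1)" unfolding a using d1_bounds(1) by (simp add: field_simps)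
      have "(1 - d2)\<^sup>2 \<le> (d1 / (1 + d1))\<^sup>2"
        using d2_bounds unfolding inv[symmetric] by (intro power_mono) auto
      then have "(1 - d2)\<^sup>2 / d2 \<le> (d1 / (1 + d1))\<^sup>2 / (1 / (1 + d1))"
        using d2_bounds d1_bounds(1) unfolding a by (intro frac_le) auto
      also have "\<dots> = d1\<^sup>2 / (1 + d1)" using d1_bounds(1) by (simp add: power2_eq_square)
      also have "\<dots> \<le> d1 / 7" using d1_bounds by (intro small)
      finally show ?thesis using d2 by linarith
    next
      case 3
      have "d3 = 1 + d1" using 3 by simp
      then have "omega (d3 - 1) \<le> d1\<^sup>2 / (1 + d1)" using d3 by simp
      also have "\<dots> \<le> d1 / 7" using d1_bounds by (intro small)
      finally show ?thesis by linarith
    qed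
  qed
  then have "7 * min (omega (d2 - 1)) (omega (d3 - 1)) \<le> d1" by simp
  then have "7 \<le> d1 / min (omega (d2 - 1)) (omega (d3 - 1))"
    using min_omega_pos by (simp only: pos_le_divide_eq)
  then show ?thesis by (simp add: \<delta>4_def)
qed

text \<open>
  \<open>\<delta>4\<close> is the reciprocal of the least value of \<open>omega (r - 1)\<close> for \<open>r\<close> outside the good interval.
\<close>

lemma bad_curvature_ratio:
  assumes "r > 0" "r < d2 \<or> d3 < r" shows "1 \<le> d4 * omega (r - 1)"
proof -
  have "min (omega (d2 - 1)) (omega (d3 - 1)) \<le> omega (r - 1)"
    using assms d2_bounds d3_gt_one omega_antimono[of r d2] omega_mono[of d3 r] by (auto simp: min_le_iff_disj)
  then show ?thesis unfolding \<delta>4_def using min_omega_pos by (simp add: pos_le_divide_eq)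
qed

text \<open>
  The quotient is the lower bound for \<open>2 p n\<close> that a unit step guarantees. Writing its logarithm as
  \<open>ln ((2 r - 1 - c) / r) - ln r - ln (1 + c)\<close> and estimating the first logarithm by
  \<open>1 - 1 / z \<le> ln z\<close> while retaining \<open>ln r\<close> keeps the terms linear in \<open>r - 1\<close> equal, so that they cancel and a multiple of
  \<open>omega (r - 1)\<close> remains.
\<close>

lemma good_step_log_bound:
  assumes r: "d2 \<le> r" "r \<le> d3" and c: "0 \<le> c" "c \<le> d1"
  shows "0 < 2 * r - 1 - c"
    and "- ln ((2 * r - 1 - c) / (r\<^sup>2 * (1 + c)))
      \<le> d5 * omega (r - 1) + (1 + (1 - ln d2) / (2 * d2 - 1 - d1)) * c"
proof -
  let ?D = "2 * d2 - 1 - d1" and ?w = "omega (r - 1)"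
  have r0: "r > 0" using r d2_bounds by linarith
  have D: "?D \<le> 2 * r - 1 - c" using r c by simp
  then show pos: "0 < 2 * r - 1 - c" using denominator_pos by linarith
  have w: "?w \<ge> 0" using omega_nonneg[OF r0] .
  define K where "K = max (2 + 2 / d2) (4 * d3)"
  have K: "max (2 + 2 / r) (4 * r) \<le> K"
    unfolding K_def using r r0 d2_bounds by (intro max.mono add_left_mono divide_left_mono mult_left_mono) auto
  have "c * (- ln r) \<le> c * (- ln d2)" using c r d2_bounds by (intro mult_left_mono) auto
  moreover have "2 * (r - 1) * ln r \<le> K * ?w"
    using ln_times_le_omega[OF r0] mult_right_mono[OF K w] by linarith
  ultimately have num: "c - c * ln r - ?w + 2 * (r - 1) * ln r \<le> K * ?w + c * (1 - ln d2)"
    using w by (simp add: algebra_simps)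
  have K0: "K \<ge> 0" unfolding K_def using d3_gt_one by (auto simp: le_max_iff_disj)
  have rhs0: "K * ?w + c * (1 - ln d2) \<ge> 0"
    using w K0 c ln_d2_nonpos by (intro add_nonneg_nonneg mult_nonneg_nonneg) auto
  have "- ln ((2 * r - 1 - c) / (r\<^sup>2 * (1 + c))) = ln (1 + c) + ln r - ln ((2 * r - 1 - c) / r)"
    using pos r0 c by (simp add: ln_div ln_mult ln_realpow power2_eq_square)
  also have "\<dots> \<le> c + ln r + (r / (2 * r - 1 - c) - 1)"
    using ln_add_one_self_le_self[OF c(1)] ln_ge_one_minus_inverse[of "(2 * r - 1 - c) / r"] pos r0
    by simp
  also have "\<dots> = c + (c - c * ln r - ?w + 2 * (r - 1) * ln r) / (2 * r - 1 - c)"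
    using pos by (simp add: omega_shift divide_simps) (simp add: algebra_simps)
  also have "\<dots> \<le> c + (K * ?w + c * (1 - ln d2)) / (2 * r - 1 - c)"
    using pos by (intro add_left_mono divide_right_mono num) auto
  also have "\<dots> \<le> c + (K * ?w + c * (1 - ln d2)) / ?D"
    using D denominator_pos pos rhs0 by (intro add_left_mono divide_left_mono) auto
  also have "\<dots> = d5 * ?w + (1 + (1 - ln d2) / ?D) * c"
  proof -
    have "(K * ?w + c * (1 - ln d2)) / ?D = K / ?D * ?w + (1 - ln d2) / ?D * c"
      by (simp add: add_divide_distrib mult.commute)
    then show ?thesis unfolding \<delta>5_def K_def[symmetric] by (simp add: distrib_right)
  qed
  finally show "- ln ((2 * r - 1 - c) / (r\<^sup>2 * (1 + c)))
      \<le> d5 * omega (r - 1) + (1 + (1 - ln d2) / (2 * d2 - 1 - d1)) * c" .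
qed

end

section \<open>Elementary estimates for sums and products\<close>

text \<open>
  The margin below 3 is what later absorbs the rounding of iteration counts; 2.75 would not be enough.
\<close>

lemma exp_one_le: "exp 1 \<le> (273 / 100 :: real)"
proof -
  have "(127 / 128 :: real) ^ 128 \<le> exp (- 1 / 128) ^ 128"
    using exp_ge_add_one_self[of "- 1 / 128 :: real"] by (intro power_mono) auto
  also have "\<dots> = exp (- 1)" by (simp flip: exp_of_nat_mult)
  finally have "(127 / 128 :: real) ^ 128 \<le> 1 / exp 1" by (simp add: exp_minus field_simps)
  then have "exp 1 \<le> 1 / (127 / 128 :: real) ^ 128" by (simp add: field_simps)
  also have "\<dots> \<le> 273 / 100" by (simp add: power_divide)
  finally show ?thesis .
qed

lemma prod_le_mean_power:
  fixes a :: "nat \<Rightarrow> real"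
  assumes "t > 0" and a: "\<And>k. k < t \<Longrightarrow> 0 \<le> a k"
  shows "(\<Prod>k<t. a k) \<le> ((\<Sum>k<t. a k) / real t) ^ t"
proof -
  let ?P = "\<Prod>k<t. a k"
  have P: "?P \<ge> 0" using a by (intro prod_nonneg) auto
  have "?P powr (1 / real t) \<le> (\<Sum>k<t. a k) / real t"
    using arith_geom_mean[of "{..<t}" a] a assms(1) by (auto simp: sum_divide_distrib)
  then have "(?P powr (1 / real t)) ^ t \<le> ((\<Sum>k<t. a k) / real t) ^ t"
    by (intro power_mono) auto
  moreover have "(?P powr (1 / real t)) ^ t = ?P"
  proof (cases "?P = 0")
    case True
    show ?thesis unfolding True using assms(1) by simp
  next
    case False
    then have "?P powr (1 / real t) > 0" using P by (simp only: powr_gt_zero not_False_eq_True)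
    then have "(?P powr (1 / real t)) ^ t = (?P powr (1 / real t)) powr real t"
      by (rule powr_realpow[symmetric])
    also have "\<dots> = ?P" unfolding powr_powr using assms(1) P by simp
    finally show ?thesis .
  qed
  ultimately show ?thesis by simp
qed

lemma sum_exp_le:
  assumes "w > 0" shows "(\<Sum>k=1..n. exp (- (real k * w))) \<le> 1 / w"
proof -
  have "w * (\<Sum>k=1..n. exp (- (real k * w))) \<le> 1 - exp (- (real n * w))"
  proof (induction n)
    case (Suc n)
    have "(1 + w) * exp (- (real (Suc n) * w)) \<le> exp w * exp (- (real (Suc n) * w))"
      by (intro mult_right_mono) auto
    also have "\<dots> = exp (- (real n * w))" by (simp add: algebra_simps flip: exp_add)
    finally show ?case using Suc by (simp add: algebra_simps)
  qed simp
  also have "\<dots> \<le> 1" by simp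
  finally show ?thesis using assms by (simp add: field_simps)
qed

text \<open>
  Index 0 is left out so that no rounding error occurs; it is accounted for separately.
\<close>

lemma card_positive_below:
  assumes "y \<ge> 0" shows "real (card {k\<in>{1..n}. real k < y}) \<le> y"
proof -
  have "{k\<in>{1..n}. real k < y} \<subseteq> {1..nat \<lfloor>y\<rfloor>}" by (auto simp: le_nat_floor)
  then have "card {k\<in>{1..n}. real k < y} \<le> nat \<lfloor>y\<rfloor>"
    by (metis card_atLeastAtMost card_mono diff_Suc_1 finite_atLeastAtMost)
  then show ?thesis using assms by linarith
qed

section \<open>Descent near the minimizer\<close>

context smooth_strongly_convex
begin

lemma mu_le_L:
  assumes "G z \<noteq> 0" shows "\<mu> \<le> L"
proof -
  have "\<mu> * (norm (G z))\<^sup>2 \<le> L * (norm (G z))\<^sup>2"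
    using hessian_lower[of "G z" z] hessian_upper[of "G z" z] by linarith
  then show ?thesis using assms by simp
qed

lemma descent_quadratic_bound:
  assumes "f (a + s) \<le> f a"
  shows "f (a + s) \<le> f a + G a \<bullet> s + (1 + C a) / 2 * (s \<bullet> (H x_star *v s))"
proof -
  obtain \<tau> where \<tau>: "0 < \<tau>" "\<tau> \<le> 1"
    "f (a + s) = f a + G a \<bullet> s + (s \<bullet> (H (a + \<tau> *\<^sub>R s) *v s)) / 2"
    using second_order_taylor by blast
  have "s \<bullet> (H (a + \<tau> *\<^sub>R s) *v s) \<le> (1 + C a) * (s \<bullet> (H x_star *v s))"
    using \<tau> by (intro hessian_le_optimal descent_segment_distance assms) auto
  then show ?thesis using \<tau>(3) by simp
qed

lemma C_squared: "(C z)\<^sup>2 = 2 * M\<^sup>2 * gap z / \<mu> ^ 3"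
proof -
  have "(C z)\<^sup>2 = M\<^sup>2 * (sqrt (2 * gap z))\<^sup>2 / (\<mu>\<^sup>2 * (sqrt \<mu>)\<^sup>2)"
    unfolding C_def mu_powr by (simp only: power_mult_distrib power_divide times_divide_eq_left)
  also have "(sqrt (2 * gap z))\<^sup>2 = 2 * gap z" using gap_nonneg[of z] by simp
  also have "(sqrt \<mu>)\<^sup>2 = \<mu>" using mu_pos by simp
  finally show ?thesis by (simp add: power2_eq_square power3_eq_cube)
qed

text \<open>
  Bounding the Hessian on the segment by \<open>C a\<close> presupposes that the step decreases \<open>f\<close>, which is proved
  first from a crude bound: the step has length at most a quarter of \<open>\<mu> / M\<close>, so on the segment the
  Hessian is at most \<open>1 + 1 / 6 + 1 / 4\<close> times that at the minimizer, and half of this is below \<open>7 / 8\<close>.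
\<close>

lemma unit_step_descends:
  assumes small: "C a \<le> 1 / 6" and v: "v \<noteq> 0"
    and ratio: "7 / 8 * (v \<bullet> (H x_star *v v)) \<le> - (G a \<bullet> v)"
  shows "f (a + v) \<le> f a"
proof -
  define D where "D = v \<bullet> (H x_star *v v)"
  have D: "D > 0" unfolding D_def by (rule spd_pos[OF hessian_spd v])
  let ?g = "G a \<bullet> (matrix_inv (H x_star) *v G a)"
  have "(G a \<bullet> v)\<^sup>2 \<le> ?g * D"
  proof -
    let ?u = "matrix_inv (H x_star) *v G a"
    have "H x_star *v ?u = G a"
      by (rule mult_matrix_inv_vector[OF hessian_spd])
    then show ?thesis
      using spd_cauchy_schwarz[OF hessian_spd, of v x_star ?u] by (simp add: D_def inner_commute mult.commute)
  qed
  moreover have "(7 / 8 * D)\<^sup>2 \<le> (- (G a \<bullet> v))\<^sup>2"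
    using ratio D by (intro power_mono) (auto simp: D_def)
  ultimately have "(7 / 8)\<^sup>2 * D * D \<le> ?g * D" by (simp add: power2_eq_square)
  then have "(7 / 8)\<^sup>2 * D \<le> ?g" using D by (simp only: mult_le_cancel_right_pos)
  also have "?g \<le> 2 * (1 + C a) ^ 3 * gap a" by (rule weighted_gradient_le_gap)
  also have "\<dots> \<le> 2 * (7 / 6) ^ 3 * gap a"
    using small C_nonneg[of a] gap_nonneg[of a] by (intro mult_right_mono mult_left_mono power_mono) auto
  finally have Dg: "D \<le> 2 * (8 / 7)\<^sup>2 * (7 / 6) ^ 3 * gap a" by (simp add: power2_eq_square)
  have "\<mu> * (norm v)\<^sup>2 \<le> D" unfolding D_def by (rule hessian_lower)
  then have "(norm v)\<^sup>2 \<le> D / \<mu>" using mu_pos by (simp add: pos_le_divide_eq mult.commute)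
  have "(M * norm v / \<mu>)\<^sup>2 = M\<^sup>2 / \<mu>\<^sup>2 * (norm v)\<^sup>2" by (simp add: power_mult_distrib power_divide)
  also have "\<dots> \<le> M\<^sup>2 / \<mu>\<^sup>2 * ((2 * (8 / 7)\<^sup>2 * (7 / 6) ^ 3 * gap a) / \<mu>)"
    using \<open>(norm v)\<^sup>2 \<le> D / \<mu>\<close> Dg mu_pos
    by (intro mult_left_mono order_trans[OF \<open>(norm v)\<^sup>2 \<le> D / \<mu>\<close>] divide_right_mono) auto
  also have "\<dots> = (8 / 7)\<^sup>2 * (7 / 6) ^ 3 * (C a)\<^sup>2"
    unfolding C_squared using mu_pos by (simp add: power2_eq_square power3_eq_cube)
  also have "\<dots> \<le> (8 / 7)\<^sup>2 * (7 / 6) ^ 3 * (1 / 6)\<^sup>2"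
    using small C_nonneg[of a] by (intro mult_left_mono power_mono) auto
  also have "\<dots> \<le> (1 / 4)\<^sup>2" by (simp add: power2_eq_square power3_eq_cube)
  finally have vb: "M * norm v / \<mu> \<le> 1 / 4" by (rule power2_le_imp_le) simp
  obtain \<tau> where \<tau>: "0 < \<tau>" "\<tau> \<le> 1"
    "f (a + v) = f a + G a \<bullet> v + (v \<bullet> (H (a + \<tau> *\<^sub>R v) *v v)) / 2"
    using second_order_taylor by blast
  have "M * norm (a + \<tau> *\<^sub>R v - x_star) / \<mu> \<le> 5 / 12"
  proof -
    have "norm (a + \<tau> *\<^sub>R v - x_star) = norm ((a - x_star) + \<tau> *\<^sub>R v)" by (simp add: algebra_simps)
    also have "\<dots> \<le> norm (a - x_star) + norm (\<tau> *\<^sub>R v)" by (rule norm_triangle_ineq)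
    also have "norm (\<tau> *\<^sub>R v) \<le> norm v" using \<tau> by (simp add: mult_left_le_one_le)
    finally have "M / \<mu> * norm (a + \<tau> *\<^sub>R v - x_star) \<le> M / \<mu> * (norm (a - x_star) + norm v)"
      using M_pos mu_pos by (intro mult_left_mono) auto
    also have "\<dots> = M * norm (a - x_star) / \<mu> + M * norm v / \<mu>" by (simp add: distrib_left)
    also have "\<dots> \<le> 1 / 6 + 1 / 4" using distance_le_C[of a] small vb by linarith
    finally show ?thesis by simp
  qed
  from hessian_le_optimal[OF this, of v]
  have "v \<bullet> (H (a + \<tau> *\<^sub>R v) *v v) \<le> 17 / 12 * D" by (simp add: D_def)
  then show ?thesis using \<tau>(3) ratio D unfolding D_def[symmetric] by linarith
qed

end

section \<open>The progress of one BFGS iteration\<close>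

locale bfgs_run = smooth_strongly_convex f G H \<mu> L M x_star + line_search_parameters \<alpha> \<beta>
  for f :: "real^'n \<Rightarrow> real" and G :: "real^'n \<Rightarrow> real^'n" and H :: "real^'n \<Rightarrow> real^'n^'n"
    and \<mu> L M :: real and x_star :: "real^'n" and \<alpha> \<beta> :: real +
  fixes \<eta> :: "nat \<Rightarrow> real" and x :: "nat \<Rightarrow> real^'n" and B :: "nat \<Rightarrow> real^'n^'n"
  assumes initial_spd: "spd (B 0)"
    and iteration: "bfgs_iteration G \<eta> x B"
    and nonoptimal: "\<And>k. G (x k) \<noteq> 0"
    and line_search:
      "\<And>k. armijo_wolfe \<alpha> \<beta> f G (x k) (bfgs_direction (B k) (G (x k))) (\<eta> k)"
    and unit_step:
      "\<And>k. armijo_wolfe \<alpha> \<beta> f G (x k) (bfgs_direction (B k) (G (x k))) 1 \<Longrightarrow> \<eta> k = 1"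
begin

definition dir :: "nat \<Rightarrow> real^'n" where "dir k = bfgs_direction (B k) (G (x k))"
definition s :: "nat \<Rightarrow> real^'n" where "s k = x (Suc k) - x k"
definition y :: "nat \<Rightarrow> real^'n" where "y k = G (x (Suc k)) - G (x k)"

lemma eta_pos: "\<eta> k > 0"
  and s_eq: "s k = \<eta> k *\<^sub>R dir k"
  and x_Suc: "x (Suc k) = x k + s k"
  and B_Suc: "B (Suc k) = bfgs_update (B k) (s k) (y k)"
  using iteration by (auto simp: bfgs_iteration_def s_def y_def dir_def)

lemma B_dir:
  assumes "spd (B k)" shows "B k *v dir k = - G (x k)"
proof -
  have "B k *v (matrix_inv (B k) *v G (x k)) = G (x k)"
    by (rule mult_matrix_inv_vector[OF assms])
  then show ?thesis
    using matrix_vector_mult_diff_distrib[of "B k" 0 "matrix_inv (B k) *v G (x k)"]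
    by (simp add: dir_def bfgs_direction_def)
qed

lemma secant_pos:
  assumes "s k \<noteq> 0" shows "s k \<bullet> y k > 0"
proof -
  have "0 < \<mu> * (norm (s k))\<^sup>2" using assms mu_pos by simp
  then show ?thesis
    using gradient_strongly_monotone[of "x (Suc k)" "x k"] by (simp add: s_def y_def inner_commute)
qed

lemma spd_B: "spd (B k)"
proof (induction k)
  case (Suc k)
  have "dir k \<noteq> 0" using B_dir[OF Suc] nonoptimal[of k] by auto
  then have "s k \<bullet> y k > 0" using eta_pos[of k] by (intro secant_pos) (simp add: s_eq)
  then show ?case unfolding B_Suc by (intro spd_bfgs_update Suc)
qed (rule initial_spd)

lemma dir_nonzero: "dir k \<noteq> 0"
  using B_dir[OF spd_B, of k] nonoptimal[of k] by auto

lemma s_nonzero: "s k \<noteq> 0"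
  using dir_nonzero eta_pos[of k] by (simp add: s_eq)

lemma sy_pos: "s k \<bullet> y k > 0"
  by (rule secant_pos[OF s_nonzero])

lemma B_s: "B k *v s k = - (\<eta> k *\<^sub>R G (x k))"
  by (simp add: s_eq matrix_vector_mult_scaleR B_dir[OF spd_B])

lemma sBs: "s k \<bullet> (B k *v s k) = \<eta> k * - (G (x k) \<bullet> s k)"
  by (simp add: B_s inner_commute)

lemma sBs_pos: "s k \<bullet> (B k *v s k) > 0"
  by (rule spd_pos[OF spd_B s_nonzero])

lemma slope_pos: "- (G (x k) \<bullet> s k) > 0"
  using sBs_pos[of k] eta_pos[of k] unfolding sBs by (simp only: zero_less_mult_pos)

lemma armijo: "\<alpha> * - (G (x k) \<bullet> s k) \<le> f (x k) - f (x (Suc k))"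
  using line_search[of k] unfolding armijo_wolfe_def dir_def[symmetric] s_eq[symmetric] x_Suc[symmetric]
  by (simp add: s_eq)

lemma curvature: "(1 - \<beta>) * - (G (x k) \<bullet> s k) \<le> s k \<bullet> y k"
proof -
  have "\<beta> * (G (x k) \<bullet> dir k) \<le> G (x (Suc k)) \<bullet> dir k"
    using line_search[of k] unfolding armijo_wolfe_def dir_def[symmetric] s_eq[symmetric] x_Suc[symmetric]
    by simp
  then have "\<eta> k * (\<beta> * (G (x k) \<bullet> dir k)) \<le> \<eta> k * (G (x (Suc k)) \<bullet> dir k)"
    using eta_pos[of k] by (intro mult_left_mono) auto
  then show ?thesis by (simp add: y_def s_eq inner_diff_right inner_commute algebra_simps)
qed

lemma decrease_pos: "f (x k) - f (x (Suc k)) > 0"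
  using armijo[of k] mult_pos_pos[OF alpha_pos slope_pos[of k]] by linarith

lemma f_decreasing: "k \<le> l \<Longrightarrow> f (x l) \<le> f (x k)"
proof (induction l rule: dec_induct)
  case (step m)
  then show ?case using decrease_pos[of m] by linarith
qed simp

definition gap_at :: "nat \<Rightarrow> real" where "gap_at k = gap (x k)"
definition c :: "nat \<Rightarrow> real" where "c k = C (x k)"
text \<open>
  \<open>r\<close> is the fraction of the gap that is removed. The quotients \<open>p\<close> and \<open>n\<close> compare the decrease and
  the curvature along the step with the slope: the first line search condition says \<open>p \<ge> \<alpha>\<close>, the
  second \<open>n \<ge> 1 - \<beta>\<close>, and the exact minimizer along the direction of a quadratic has \<open>p = 1 / 2\<close> and
  \<open>n = 1\<close>, so that \<open>2 p n = 1\<close>.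
\<close>

definition r :: "nat \<Rightarrow> real" where "r k = (f (x k) - f (x (Suc k))) / gap_at k"
definition p :: "nat \<Rightarrow> real" where "p k = (f (x k) - f (x (Suc k))) / - (G (x k) \<bullet> s k)"
definition n :: "nat \<Rightarrow> real" where "n k = (s k \<bullet> y k) / - (G (x k) \<bullet> s k)"

lemma gap_at_pos: "gap_at k > 0"
  unfolding gap_at_def by (rule gap_pos[OF nonoptimal])

lemma r_pos: "r k > 0"
  unfolding r_def using decrease_pos gap_at_pos by simp

lemma gap_at_Suc: "gap_at (Suc k) = (1 - r k) * gap_at k"
proof -
  have "r k * gap_at k = f (x k) - f (x (Suc k))" using gap_at_pos[of k] by (simp add: r_def)
  moreover have "gap_at (Suc k) = gap_at k - (f (x k) - f (x (Suc k)))" by (simp add: gap_at_def gap_def)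
  ultimately show ?thesis by (simp add: left_diff_distrib)
qed

lemma r_less_one: "r k < 1"
  using gap_at_Suc[of k] gap_at_pos[of "Suc k"] gap_at_pos[of k] by (simp add: zero_less_mult_iff)

lemma log_ratio_nonpos: "ln (r k) \<le> 0"
  using r_pos[of k] r_less_one[of k] by simp

lemma gap_at_prod: "gap_at t = (\<Prod>k<t. 1 - r k) * gap_at 0"
  by (induction t) (simp_all add: gap_at_Suc)

lemma p_ge: "\<alpha> \<le> p k"
  using armijo[of k] slope_pos[of k] unfolding p_def by (simp only: pos_le_divide_eq)

lemma n_ge: "1 - \<beta> \<le> n k"
  using curvature[of k] slope_pos[of k] unfolding n_def by (simp only: pos_le_divide_eq)

lemma pn_ge: "\<alpha> * (1 - \<beta>) \<le> p k * n k"
  using p_ge[of k] n_ge[of k] alpha_pos beta_less_one by (intro mult_mono) auto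

lemma pn_pos: "p k * n k > 0"
  using pn_ge alpha_beta_quarter(2) by (rule less_le_trans[rotated])

text \<open>
  Let \<open>g\<close> be the squared weighted gradient norm, \<open>\<sigma>\<close> the negative slope \<open>- G (x k) \<bullet> s k\<close>, \<open>m\<close> the
  curvature \<open>s k \<bullet> y k\<close> and \<open>b\<close> the form of \<open>B\<^sub>k\<close> at the step. Then \<open>r\<close> is \<open>p n (g / gap) (\<sigma>\<^sup>2 / (g m))\<close>.
  As \<open>B s\<close> is a multiple of the gradient, the last factor is \<open>b / (m z)\<close>, where \<open>z\<close> is exactly the
  quantity subtracted from the trace by the update; \<open>ln z \<le> z - 1\<close> then turns it into the
  increment of \<open>Psi\<close>.
\<close>

lemma log_ratio_lower:
  assumes W: "spd W"
  shows "ln (r k) \<ge> ln (p k * n k) + ln ((G (x k) \<bullet> (W *v G (x k))) / gap_at k)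
    + (Psi (W ** B (Suc k)) - Psi (W ** B k)) + (1 - (y k \<bullet> (W *v y k)) / (s k \<bullet> y k))"
proof -
  define g where "g = G (x k) \<bullet> (W *v G (x k))"
  define \<sigma> where "\<sigma> = - (G (x k) \<bullet> s k)"
  define z where "z = \<eta> k * g / \<sigma>"
  define b where "b = s k \<bullet> (B k *v s k)"
  define m where "m = s k \<bullet> y k"
  define \<Delta> where "\<Delta> = f (x k) - f (x (Suc k))"
  have g: "g > 0" unfolding g_def by (rule spd_pos[OF W nonoptimal])
  have \<sigma>: "\<sigma> > 0" unfolding \<sigma>_def by (rule slope_pos)
  have z: "z > 0" using g \<sigma> eta_pos[of k] by (simp add: z_def)
  have b: "b = \<eta> k * \<sigma>" by (simp add: b_def \<sigma>_def sBs)
  have b0: "b > 0" unfolding b_def by (rule sBs_pos)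
  have m: "m > 0" unfolding m_def by (rule sy_pos)
  have \<Delta>: "\<Delta> > 0" unfolding \<Delta>_def by (rule decrease_pos)
  have gap_at: "gap_at k > 0" by (rule gap_at_pos)
  have WB: "W *v (B k *v s k) = - (\<eta> k *\<^sub>R (W *v G (x k)))"
    using matrix_vector_mult_diff_distrib[of W 0 "\<eta> k *\<^sub>R G (x k)"]
    by (simp add: B_s matrix_vector_mult_scaleR)
  have "((B k *v s k) \<bullet> (W *v (B k *v s k))) / b = z"
    unfolding WB b z_def using eta_pos[of k] by (simp add: B_s g_def)
  then have Psi: "Psi (W ** B (Suc k)) = Psi (W ** B k) - z + (y k \<bullet> (W *v y k)) / m - ln (m / b)"
    unfolding B_Suc using Psi_bfgs_update[OF W spd_B sy_pos, of k] by (simp add: b_def m_def)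
  have "r k = (p k * n k) * (g / gap_at k) * (b / (m * z))"
    unfolding r_def p_def n_def \<Delta>_def[symmetric] \<sigma>_def[symmetric] m_def[symmetric] b z_def
    using g \<sigma> m gap_at eta_pos[of k] by (simp add: field_simps)
  moreover have "b / (m * z) > 0" "g / gap_at k > 0" using b0 m z g gap_at by auto
  ultimately have "ln (r k) = ln (p k * n k) + ln (g / gap_at k) + ln (b / (m * z))"
    using pn_pos[of k] by (simp only: ln_mult_pos mult_pos_pos)
  also have "ln (b / (m * z)) = - ln (m / b) - ln z" using b0 m z by (simp add: ln_div ln_mult)
  finally show ?thesis using Psi ln_le_minus_one[OF z] by (simp add: g_def m_def)
qed

section \<open>The linear phase\<close>

definition \<kappa> :: real where "\<kappa> = L / \<mu>"

lemma kappa_ge_one: "\<kappa> \<ge> 1"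
  using mu_le_L[OF nonoptimal[of 0]] mu_pos by (simp add: \<kappa>_def)

lemma smoothness_weight: "spd (L *\<^sub>R mat 1 :: real^'n^'n)" "matrix_inv (L *\<^sub>R mat 1) = ((1 / L) *\<^sub>R mat 1 :: real^'n^'n)"
proof -
  show "spd (L *\<^sub>R mat 1 :: real^'n^'n)"
    using L_pos by (simp add: spd_def transpose_scalar scaleR_matrix_vector_assoc[symmetric])
  show "matrix_inv (L *\<^sub>R mat 1) = ((1 / L) *\<^sub>R mat 1 :: real^'n^'n)"
    using L_pos by (intro matrix_inv_unique) (simp add: matrix_eq scaleR_matrix_vector_assoc[symmetric] matrix_vector_mult_scaleR flip: matrix_vector_mul_assoc)
qed

definition Psi_bar :: "nat \<Rightarrow> real" where "Psi_bar k = Psi (((1 / L) *\<^sub>R mat 1) ** B k)"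
definition Psi_tilde :: "nat \<Rightarrow> real" where "Psi_tilde k = Psi (matrix_inv (H x_star) ** B k)"

lemma Psi_bar_nonneg: "Psi_bar k \<ge> 0"
  unfolding Psi_bar_def using spd_matrix_inv[OF smoothness_weight(1)]
  by (intro Psi_mult_nonneg spd_B) (simp add: smoothness_weight)

lemma Psi_tilde_nonneg: "Psi_tilde k \<ge> 0"
  unfolding Psi_tilde_def by (intro Psi_mult_nonneg spd_B spd_matrix_inv hessian_spd)

lemma log_ratio_lower_bar:
  "ln (r k) \<ge> ln (2 * (\<alpha> * (1 - \<beta>)) / \<kappa>) + (Psi_bar (Suc k) - Psi_bar k)"
proof -
  let ?W = "(1 / L) *\<^sub>R mat 1 :: real^'n^'n"
  have W: "spd ?W" using spd_matrix_inv[OF smoothness_weight(1)] by (simp add: smoothness_weight)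
  have Wv: "v \<bullet> (?W *v v) = (norm v)\<^sup>2 / L" for v :: "real^'n"
    by (simp add: scaleR_matrix_vector_assoc[symmetric] power2_norm_eq_inner)
  have "y k \<bullet> (matrix_inv (L *\<^sub>R mat 1) *v y k) \<le> 1 * (s k \<bullet> y k)"
    using secant_weighted_bound[OF smoothness_weight(1), of 1 "x k" "s k"] hessian_upper
    by (simp add: y_def x_Suc scaleR_matrix_vector_assoc[symmetric] power2_norm_eq_inner)
  then have "y k \<bullet> (?W *v y k) \<le> 1 * (s k \<bullet> y k)" by (simp only: smoothness_weight)
  then have sec: "(y k \<bullet> (?W *v y k)) / (s k \<bullet> y k) \<le> 1" using sy_pos[of k] by (simp only: pos_divide_le_eq)
  have "2 / \<kappa> \<le> (G (x k) \<bullet> (?W *v G (x k))) / gap_at k"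
    unfolding Wv using gap_le_gradient[of "x k"] gap_at_pos[of k] L_pos mu_pos
    by (simp add: \<kappa>_def gap_at_def[symmetric] field_simps)
  then have "ln (2 / \<kappa>) \<le> ln ((G (x k) \<bullet> (?W *v G (x k))) / gap_at k)"
    using kappa_ge_one by (intro ln_mono) auto
  moreover have "ln (\<alpha> * (1 - \<beta>)) \<le> ln (p k * n k)"
    using pn_ge alpha_beta_quarter(2) by (intro ln_mono)
  moreover have "ln (2 * (\<alpha> * (1 - \<beta>)) / \<kappa>) = ln (\<alpha> * (1 - \<beta>)) + ln (2 / \<kappa>)"
  proof -
    have "2 * (\<alpha> * (1 - \<beta>)) / \<kappa> = (\<alpha> * (1 - \<beta>)) * (2 / \<kappa>)" by simp
    also have "ln \<dots> = ln (\<alpha> * (1 - \<beta>)) + ln (2 / \<kappa>)"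
      using alpha_beta_quarter(2) kappa_ge_one by (intro ln_mult_pos) auto
    finally show ?thesis .
  qed
  ultimately show ?thesis using log_ratio_lower[OF W, of k] sec by (simp add: Psi_bar_def)
qed

text \<open>
  \<open>C\<close> is proportional to the square root of the gap, so it decreases at half the exponential rate
  of the gap. The factor \<open>exp 1\<close> is the price for an initial potential as large as the iteration count.
\<close>

definition rate :: real where "rate = \<alpha> * (1 - \<beta>) / (exp 1 * \<kappa>)"

lemma rate_pos: "rate > 0"
  unfolding rate_def using alpha_beta_quarter(2) kappa_ge_one by simp

text \<open>
  Summing the logarithmic bound over \<open>t\<close> iterations gives a mean of \<open>ln r\<close> of at least
  \<open>ln (2 \<alpha> (1 - \<beta>) / \<kappa>) - 1\<close>, since the potential contributes at most 1 on average. The tangent of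
  \<open>exp\<close> at that value converts this into a lower bound for the sum of the \<open>r\<close>.
\<close>

lemma linear_phase:
  assumes t: "Psi_bar 0 \<le> real t"
  shows "gap_at t \<le> exp (- (2 * real t * rate)) * gap_at 0"
proof -
  let ?a = "ln (2 * (\<alpha> * (1 - \<beta>)) / \<kappa>)"
  have e: "exp (?a - 1) = 2 * rate"
    using alpha_beta_quarter(2) kappa_ge_one by (simp add: exp_diff rate_def)
  have "real t * ?a + (Psi_bar t - Psi_bar 0) \<le> (\<Sum>k<t. ln (r k))"
  proof (induction t)
    case (Suc t)
    then show ?case using log_ratio_lower_bar[of t] by (simp add: algebra_simps)
  qed simp
  then have S: "real t * (?a - 1) \<le> (\<Sum>k<t. ln (r k))"
    using t Psi_bar_nonneg[of t] by (simp add: algebra_simps)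
  have "2 * rate * real t \<le> 2 * rate * (\<Sum>k<t. 1 + (ln (r k) - (?a - 1)))"
    using S rate_pos by (intro mult_left_mono) (auto simp: sum.distrib sum_subtractf algebra_simps)
  also have "\<dots> \<le> (\<Sum>k<t. r k)"
    unfolding sum_distrib_left
  proof (rule sum_mono)
    fix k
    have "2 * rate * (1 + (ln (r k) - (?a - 1))) \<le> 2 * rate * exp (ln (r k) - (?a - 1))"
      using rate_pos by (intro mult_left_mono exp_ge_add_one_self) auto
    also have "\<dots> = r k" unfolding e[symmetric] exp_add[symmetric] using r_pos[of k] by simp
    finally show "2 * rate * (1 + (ln (r k) - (?a - 1))) \<le> r k" .
  qed
  finally have R: "2 * real t * rate \<le> (\<Sum>k<t. r k)" by (simp add: mult_ac)
  have "(\<Prod>k<t. 1 - r k) \<le> (\<Prod>k<t. exp (- r k))"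
    using r_less_one exp_ge_add_one_self[of "- r _"] by (intro prod_mono) (auto simp: less_imp_le)
  also have "\<dots> = exp (- (\<Sum>k<t. r k))" by (simp add: sum_negf flip: exp_sum)
  also have "\<dots> \<le> exp (- (2 * real t * rate))" using R by simp
  finally show ?thesis unfolding gap_at_prod[of t] using gap_at_pos[of 0] by (intro mult_right_mono) auto
qed

lemma c_nonneg: "c k \<ge> 0"
  unfolding c_def by (rule C_nonneg)

lemma c_le_c0: "c k \<le> c 0"
  unfolding c_def by (intro C_mono f_decreasing) simp

lemma c_linear_phase:
  assumes "Psi_bar 0 \<le> real t"
  shows "c t \<le> c 0 * exp (- (real t * rate))"
proof -
  have "sqrt (2 * gap_at t) \<le> sqrt (2 * (exp (- (2 * real t * rate)) * gap_at 0))"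
    using linear_phase[OF assms] by simp
  also have "\<dots> = sqrt ((exp (- (real t * rate)))\<^sup>2 * (2 * gap_at 0))"
    by (simp add: power2_eq_square mult_ac flip: exp_add)
  also have "\<dots> = exp (- (real t * rate)) * sqrt (2 * gap_at 0)" by (simp add: real_sqrt_mult)
  finally have "M / (\<mu> powr (3 / 2)) * sqrt (2 * gap_at t)
    \<le> M / (\<mu> powr (3 / 2)) * (exp (- (real t * rate)) * sqrt (2 * gap_at 0))"
    using M_pos mu_pos by (intro mult_left_mono) auto
  then show ?thesis by (simp add: c_def C_def gap_at_def mult_ac)
qed

text \<open>
  The unit in which the bound counts iterations: \<open>3 K\<close> is the coefficient \<open>3 \<kappa> / (\<alpha> (1 - \<beta>))\<close>.
\<close>

definition K :: real where "K = \<kappa> / (\<alpha> * (1 - \<beta>))"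

lemma K_ge: "K \<ge> 4"
proof -
  have "4 * (\<alpha> * (1 - \<beta>)) \<le> \<kappa>" using alpha_beta_quarter(1) kappa_ge_one by linarith
  then show ?thesis unfolding K_def using alpha_beta_quarter(2) by (simp only: pos_le_divide_eq)
qed

lemma inverse_rate: "1 / rate = exp 1 * K"
  by (simp add: rate_def K_def)

text \<open>
  Replacing \<open>exp 1\<close> by 3 gains enough, as \<open>K \<ge> 4\<close>, to pay for one further iteration and to leave
  \<open>1 / 14\<close>; this remainder is used in \<open>final_bound\<close>.
\<close>

lemma rate_slack: "1 + 1 / rate \<le> 3 * K - 1 / 14"
proof -
  have "27 / 100 * 4 \<le> (3 - exp 1) * K" using exp_one_le K_ge by (intro mult_mono) auto
  then show ?thesis unfolding inverse_rate by (simp add: algebra_simps)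
qed

text \<open>
  Iteration 0 and the iterations before \<open>Psi_bar 0\<close> contribute at most \<open>c 0\<close> each, and the remaining
  ones a geometric series. Both estimates are added for all \<open>k \<ge> 1\<close>.
\<close>

lemma sum_c: "(\<Sum>k<t. c k) \<le> c 0 * (Psi_bar 0 + 1 + 1 / rate)"
proof (cases t)
  case 0
  then show ?thesis using c_nonneg[of 0] Psi_bar_nonneg[of 0] rate_pos by simp
next
  case (Suc m)
  have step: "c k \<le> c 0 * ((if real k < Psi_bar 0 then 1 else 0) + exp (- (real k * rate)))" for k
  proof (cases "real k < Psi_bar 0")
    case True
    have "c 0 * 1 \<le> c 0 * (1 + exp (- (real k * rate)))" using c_nonneg by (intro mult_left_mono) auto
    then show ?thesis using True c_le_c0[of k] by simp
  next
    case False
    then show ?thesis using c_linear_phase[of k] by simp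
  qed
  have "(\<Sum>k<t. c k) = c 0 + (\<Sum>k=1..m. c k)"
    unfolding Suc by (simp only: sum.lessThan_Suc_shift sum.atLeast1_atMost_eq One_nat_def)
  also have "\<dots> \<le> c 0 + (\<Sum>k=1..m. c 0 * ((if real k < Psi_bar 0 then 1 else 0) + exp (- (real k * rate))))"
    by (intro add_left_mono sum_mono step)
  also have "\<dots> = c 0 + c 0 * (real (card {k\<in>{1..m}. real k < Psi_bar 0}) + (\<Sum>k=1..m. exp (- (real k * rate))))"
    unfolding sum_distrib_left[symmetric] sum.distrib by (simp flip: sum.inter_filter)
  also have "\<dots> \<le> c 0 + c 0 * (Psi_bar 0 + 1 / rate)"
    using card_positive_below[OF Psi_bar_nonneg] sum_exp_le[OF rate_pos] c_nonneg
    by (intro add_left_mono mult_left_mono add_mono) auto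
  finally show ?thesis by (simp add: algebra_simps)
qed

text \<open>
  Once the linear phase has begun, \<open>c k > \<delta>1\<close> forces \<open>k\<close> to be below \<open>ln (c 0 / \<delta>1) / rate\<close>. The
  additional 1 counts iteration 0; it cannot be dropped when \<open>c 0\<close> is slightly larger than \<open>\<delta>1\<close>.
\<close>

lemma card_far:
  shows "c 0 \<le> d1 \<Longrightarrow> {k\<in>{..<t}. c k > d1} = {}"
    and "real (card {k\<in>{..<t}. c k > d1}) \<le> Psi_bar 0 + 3 * K * ln_pos (c 0 / d1) + 1"
proof -
  show "c 0 \<le> d1 \<Longrightarrow> {k\<in>{..<t}. c k > d1} = {}" using c_le_c0 by (auto simp: not_less intro: order_trans)
  define Y where "Y = Psi_bar 0 + 3 * K * ln_pos (c 0 / d1)"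
  have lp: "ln_pos (c 0 / d1) \<ge> 0" "ln (c 0 / d1) \<le> ln_pos (c 0 / d1)" by (auto simp: ln_pos_def)
  have Y: "Y \<ge> 0" unfolding Y_def using Psi_bar_nonneg[of 0] K_ge lp by simp
  have "real k \<le> Y" if far: "c k > d1" for k
  proof (cases "real k < Psi_bar 0")
    case True
    moreover have "3 * K * ln_pos (c 0 / d1) \<ge> 0" using K_ge lp by simp
    ultimately show ?thesis unfolding Y_def by linarith
  next
    case False
    then have "d1 < c 0 * exp (- (real k * rate))" using far c_linear_phase[of k] by simp
    then have *: "d1 * exp (real k * rate) < c 0" by (simp add: exp_minus field_simps)
    then have "exp (real k * rate) < c 0 / d1" using d1_bounds(1) by (simp add: pos_less_divide_eq mult.commute)
    then have "real k * rate \<le> ln_pos (c 0 / d1)"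
      using lp(2) by (smt (verit) exp_gt_zero ln_exp ln_less_cancel_iff)
    then have "real k \<le> ln_pos (c 0 / d1) * (1 / rate)" using rate_pos by (simp add: field_simps)
    also have "\<dots> \<le> ln_pos (c 0 / d1) * (3 * K)" using rate_slack lp by (intro mult_left_mono) auto
    finally show ?thesis unfolding Y_def using Psi_bar_nonneg[of 0] by (simp add: mult_ac)
  qed
  then have "{k\<in>{..<t}. c k > d1} \<subseteq> {..nat \<lfloor>Y\<rfloor>}" by (auto simp: le_nat_floor)
  then have "card {k\<in>{..<t}. c k > d1} \<le> nat \<lfloor>Y\<rfloor> + 1" using card_mono[of "{..nat \<lfloor>Y\<rfloor>}"] by fastforce
  then show "real (card {k\<in>{..<t}. c k > d1}) \<le> Psi_bar 0 + 3 * K * ln_pos (c 0 / d1) + 1"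
    using Y unfolding Y_def[symmetric] by linarith
qed

section \<open>Unit steps and the superlinear phase\<close>

definition \<rho> :: "nat \<Rightarrow> real" where "\<rho> k = (s k \<bullet> (B k *v s k)) / (s k \<bullet> (H x_star *v s k))"

lemma sHs_pos: "s k \<bullet> (H x_star *v s k) > 0"
  by (rule spd_pos[OF hessian_spd s_nonzero])

lemma rho_pos: "\<rho> k > 0"
  unfolding \<rho>_def using sBs_pos sHs_pos by simp

lemma step_descends: "f (x k + s k) \<le> f (x k)"
  using decrease_pos[of k] by (simp flip: x_Suc)

lemma secant_tilde: "(y k \<bullet> (matrix_inv (H x_star) *v y k)) / (s k \<bullet> y k) \<le> 1 + c k"
  using secant_optimal_bound[OF step_descends[of k]] sy_pos[of k]
  by (simp add: y_def x_Suc c_def pos_divide_le_eq)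

lemma curvature_tilde: "s k \<bullet> (H x_star *v s k) \<le> (1 + c k) * (s k \<bullet> y k)"
  using secant_curvature_bound[OF step_descends[of k]] by (simp add: y_def x_Suc c_def)

text \<open>
  In the weight of the Hessian at the minimizer, the Cauchy-Schwarz inequality bounds the quantity
  subtracted from the trace below by \<open>\<rho>\<close>, and \<open>ln \<rho>\<close> is the change of the log determinant up to the
  relative curvature along the step. Both secant terms differ from their ideal values by at most \<open>c k\<close>.
\<close>

lemma omega_rho_le: "omega (\<rho> k - 1) \<le> Psi_tilde k - Psi_tilde (Suc k) + 2 * c k"
proof -
  let ?W = "matrix_inv (H x_star)"
  define b where "b = s k \<bullet> (B k *v s k)"
  define h where "h = s k \<bullet> (H x_star *v s k)"
  define m where "m = s k \<bullet> y k"
  define z where "z = (B k *v s k) \<bullet> (?W *v (B k *v s k))"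
  have pos: "b > 0" "h > 0" "m > 0" by (simp_all add: b_def h_def m_def sBs_pos sHs_pos sy_pos)
  have rho: "\<rho> k = b / h" by (simp add: \<rho>_def b_def h_def)
  have Psi: "Psi_tilde (Suc k) = Psi_tilde k - z / b + (y k \<bullet> (?W *v y k)) / m - ln (m / b)"
    unfolding Psi_tilde_def B_Suc z_def b_def m_def
    by (rule Psi_bfgs_update[OF spd_matrix_inv[OF hessian_spd] spd_B sy_pos])
  have "b\<^sup>2 \<le> h * z"
  proof -
    let ?u = "?W *v (B k *v s k)"
    have "H x_star *v ?u = B k *v s k"
      by (rule mult_matrix_inv_vector[OF hessian_spd])
    then show ?thesis
      using spd_cauchy_schwarz[OF hessian_spd, of "s k" x_star ?u]
      by (simp add: b_def h_def z_def inner_commute)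
  qed
  then have 1: "\<rho> k \<le> z / b" unfolding rho using pos by (simp add: divide_simps power2_eq_square mult_ac)
  have "h / m \<le> 1 + c k" using curvature_tilde[of k] pos by (simp add: h_def m_def pos_divide_le_eq)
  then have "ln (h / m) \<le> ln (1 + c k)" using pos by (intro ln_mono) auto
  then have 2: "ln (h / m) \<le> c k" using ln_add_one_self_le_self[OF c_nonneg[of k]] by linarith
  have "ln (\<rho> k) = - ln (m / b) - ln (h / m)" unfolding rho using pos by (simp add: ln_div)
  then show ?thesis using Psi 1 2 secant_tilde[of k] unfolding omega_shift m_def by linarith
qed

text \<open>
  With \<open>h\<close> the form of the Hessian at the minimizer at the direction, the slope is \<open>- \<rho> h\<close>; the decrease is
  at least \<open>\<rho> h - (1 + c) h / 2\<close> and the curvature at least \<open>h / (1 + c)\<close>. The conditions hold because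
  \<open>1 + c\<close> and \<open>\<rho>\<close> each are within the square root of the admissible factor, which is how \<open>\<delta>1\<close>,
  \<open>\<delta>2\<close> and \<open>\<delta>3\<close> are chosen.
\<close>

lemma unit_step_taken:
  assumes c: "c k \<le> d1" and r: "d2 \<le> \<rho> k" "\<rho> k \<le> d3"
  shows "\<eta> k = 1"
proof (rule unit_step)
  let ?v = "dir k"
  define h where "h = ?v \<bullet> (H x_star *v ?v)"
  have h: "h > 0" unfolding h_def by (rule spd_pos[OF hessian_spd dir_nonzero])
  have slope: "- (G (x k) \<bullet> ?v) = \<rho> k * h"
  proof -
    have "\<rho> k = (?v \<bullet> (B k *v ?v)) / h"
      using eta_pos[of k] by (simp add: \<rho>_def s_eq h_def matrix_vector_mult_scaleR)
    then show ?thesis using h by (simp add: B_dir[OF spd_B] inner_commute)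
  qed
  have "7 / 8 * h \<le> - (G (x k) \<bullet> ?v)"
    unfolding slope using h r d2_bounds by (intro mult_right_mono) auto
  then have desc: "f (x k + ?v) \<le> f (x k)"
    using c d1_bounds by (intro unit_step_descends dir_nonzero) (auto simp: c_def h_def)
  show "armijo_wolfe \<alpha> \<beta> f G (x k) (bfgs_direction (B k) (G (x k))) 1"
    unfolding armijo_wolfe_def dir_def[symmetric] scaleR_one
  proof
    let ?a = "sqrt (2 * (1 - \<alpha>))"
    have "1 + c k \<le> ?a" using c d1_bounds by linarith
    also have "?a \<le> 2 * (1 - \<alpha>) * \<rho> k"
    proof -
      have "?a * (1 / ?a) \<le> ?a * \<rho> k"
        using sqrt_alpha d2_bounds r by (intro mult_left_mono) auto
      then have "?a * 1 \<le> ?a * (?a * \<rho> k)" using sqrt_alpha by (intro mult_left_mono) auto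
      also have "\<dots> = (?a * ?a) * \<rho> k" by (simp only: mult.assoc)
      also have "?a * ?a = 2 * (1 - \<alpha>)" using alpha_less_half by simp
      finally show ?thesis by simp
    qed
    finally have "1 + c k \<le> 2 * ((1 - \<alpha>) * \<rho> k)" by (simp only: mult.assoc)
    then have "(1 + c k) / 2 \<le> (1 - \<alpha>) * \<rho> k" by simp
    then have "(1 + c k) / 2 * h \<le> (1 - \<alpha>) * \<rho> k * h" using h by (intro mult_right_mono) auto
    moreover have "f (x k + ?v) \<le> f (x k) - \<rho> k * h + (1 + c k) / 2 * h"
      using descent_quadratic_bound[OF desc] slope by (simp add: c_def h_def)
    moreover have "G (x k) \<bullet> ?v = - (\<rho> k * h)" using slope by linarith
    ultimately show "f (x k + ?v) \<le> f (x k) + \<alpha> * 1 * (G (x k) \<bullet> ?v)"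
      by (simp add: algebra_simps)
  next
    define m where "m = ?v \<bullet> (G (x k + ?v) - G (x k))"
    have hm: "h \<le> (1 + c k) * m"
      using secant_curvature_bound[OF desc] by (simp add: h_def m_def c_def)
    have "1 + c k \<le> d3" using c d1_bounds by linarith
    moreover have "m \<ge> 0"
      using hm h c_nonneg[of k] by (smt (verit) mult_pos_neg)
    ultimately have "(1 + c k) * m \<le> d3 * m" by (intro mult_right_mono)
    then have "h \<le> d3 * m" using hm by linarith
    then have "(1 - \<beta>) * d3 * h \<le> (1 - \<beta>) * d3 * (d3 * m)"
      using beta_less_one d3_gt_one by (intro mult_left_mono) auto
    also have "\<dots> = ((1 - \<beta>) * (d3 * d3)) * m" by (simp only: mult_ac)
    also have "(1 - \<beta>) * (d3 * d3) = 1" using beta_less_one by (simp add: \<delta>3_def)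
    finally have "(1 - \<beta>) * d3 * h \<le> m" by simp
    moreover have "(1 - \<beta>) * \<rho> k * h \<le> (1 - \<beta>) * d3 * h"
      using beta_less_one r h by (intro mult_right_mono mult_left_mono) auto
    ultimately have "(1 - \<beta>) * (\<rho> k * h) \<le> m" by (simp add: mult.assoc)
    moreover have "m = G (x k + ?v) \<bullet> ?v - G (x k) \<bullet> ?v"
      by (simp add: m_def inner_diff_right inner_commute)
    moreover have "G (x k) \<bullet> ?v = - (\<rho> k * h)" using slope by linarith
    ultimately show "\<beta> * (G (x k) \<bullet> ?v) \<le> G (x k + ?v) \<bullet> ?v"
      by (simp add: algebra_simps)
  qed
qed

lemma log_pn_good:
  assumes c: "c k \<le> d1" and r: "d2 \<le> \<rho> k" "\<rho> k \<le> d3"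
  shows "- ln (2 * (p k * n k)) \<le> d5 * omega (\<rho> k - 1) + (1 + (1 - ln d2) / (2 * d2 - 1 - d1)) * c k"
proof -
  have eta: "\<eta> k = 1" by (rule unit_step_taken[OF assms])
  define h where "h = s k \<bullet> (H x_star *v s k)"
  have h: "h > 0" unfolding h_def by (rule sHs_pos)
  have slope: "- (G (x k) \<bullet> s k) = \<rho> k * h"
    using h sBs[of k] eta by (simp add: \<rho>_def h_def)
  have rho: "\<rho> k > 0" by (rule rho_pos)
  note good = good_step_log_bound[OF r c_nonneg c]
  have "f (x (Suc k)) \<le> f (x k) - \<rho> k * h + (1 + c k) / 2 * h"
    using descent_quadratic_bound[OF step_descends[of k]] slope by (simp add: c_def h_def x_Suc)
  moreover have "(2 * \<rho> k - 1 - c k) / (2 * \<rho> k) * (\<rho> k * h) = \<rho> k * h - (1 + c k) / 2 * h"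
    using rho by (simp add: field_simps)
  ultimately have "(2 * \<rho> k - 1 - c k) / (2 * \<rho> k) * (\<rho> k * h) \<le> f (x k) - f (x (Suc k))"
    by linarith
  then have pk: "(2 * \<rho> k - 1 - c k) / (2 * \<rho> k) \<le> p k"
    unfolding p_def slope using rho h by (simp only: pos_le_divide_eq mult_pos_pos)
  have "1 / (\<rho> k * (1 + c k)) * (\<rho> k * h) \<le> s k \<bullet> y k"
    using curvature_tilde[of k] rho c_nonneg[of k] by (simp add: h_def divide_le_eq mult.commute)
  then have nk: "1 / (\<rho> k * (1 + c k)) \<le> n k"
    unfolding n_def slope using rho h by (simp only: pos_le_divide_eq mult_pos_pos)
  have "u / ((\<rho> k)\<^sup>2 * w) = 2 * (u / (2 * \<rho> k) * (1 / (\<rho> k * w)))" for u w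
    by (simp add: power2_eq_square)
  then have "(2 * \<rho> k - 1 - c k) / ((\<rho> k)\<^sup>2 * (1 + c k))
    = 2 * ((2 * \<rho> k - 1 - c k) / (2 * \<rho> k) * (1 / (\<rho> k * (1 + c k))))" .
  also have "\<dots> \<le> 2 * (p k * n k)"
    using pk nk good(1) rho c_nonneg[of k] p_ge[of k] alpha_pos by (intro mult_left_mono mult_mono) auto
  finally have "ln ((2 * \<rho> k - 1 - c k) / ((\<rho> k)\<^sup>2 * (1 + c k))) \<le> ln (2 * (p k * n k))"
    using good(1) rho c_nonneg[of k] by (intro ln_mono) auto
  then show ?thesis using good(2) by linarith
qed

lemma log_pn_bad: "- ln (2 * (p k * n k)) \<le> d6"
proof -
  have "ln (2 * (\<alpha> * (1 - \<beta>))) \<le> ln (2 * (p k * n k))"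
    using pn_ge[of k] alpha_beta_quarter(2) by (intro ln_mono) auto
  then show ?thesis unfolding d6_eq by simp
qed

text \<open>
  One inequality for every iteration: the constant loss \<open>\<delta>6\<close> is charged to the indicator while \<open>c k\<close> is
  large, and to \<open>\<delta>4 omega (\<rho> - 1) \<ge> 1\<close> while \<open>\<rho>\<close> is outside the good interval.
\<close>

lemma log_pn:
  "- ln (2 * (p k * n k)) \<le> d6 * (if c k > d1 then 1 else 0) + (d4 * d6 + d5) * omega (\<rho> k - 1)
    + (1 + (1 - ln d2) / (2 * d2 - 1 - d1)) * c k"
proof -
  define b where "b = 1 + (1 - ln d2) / (2 * d2 - 1 - d1)"
  have b: "b \<ge> 0" unfolding b_def
    using denominator_pos ln_d2_nonpos by (intro add_nonneg_nonneg divide_nonneg_pos) auto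
  have w: "omega (\<rho> k - 1) \<ge> 0" by (rule omega_nonneg[OF rho_pos])
  have nn: "d5 * omega (\<rho> k - 1) \<ge> 0" "b * c k \<ge> 0" "d4 * d6 * omega (\<rho> k - 1) \<ge> 0"
    using w b c_nonneg d5_nonneg d4_pos d6_nonneg by simp_all
  consider "c k > d1" | "\<rho> k < d2 \<or> d3 < \<rho> k" | "c k \<le> d1" "d2 \<le> \<rho> k" "\<rho> k \<le> d3" by linarith
  then have "- ln (2 * (p k * n k)) \<le> d6 * (if c k > d1 then 1 else 0) + (d4 * d6 + d5) * omega (\<rho> k - 1) + b * c k"
  proof cases
    case 1
    then show ?thesis using log_pn_bad[of k] nn by (simp add: distrib_right)
  next
    case 2
    have "d6 * 1 \<le> d6 * (d4 * omega (\<rho> k - 1))"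
      by (intro mult_left_mono bad_curvature_ratio rho_pos 2 d6_nonneg)
    then have "d6 \<le> d4 * d6 * omega (\<rho> k - 1)" by (simp add: mult_ac)
    then show ?thesis using log_pn_bad[of k] nn d6_nonneg by (simp add: distrib_right)
  next
    case 3
    then show ?thesis using log_pn_good[OF 3] nn d6_nonneg unfolding b_def[symmetric] by (simp add: distrib_right)
  qed
  then show ?thesis unfolding b_def .
qed

text \<open>
  Inserting \<open>omega_rho_le\<close> into \<open>log_pn\<close> leaves a telescoping term and multiples of \<open>c k\<close>; the coefficients
  that arise are at most \<open>\<delta>7\<close> and \<open>\<delta>8\<close>.
\<close>

lemma step_bound:
  "- ln (r k) \<le> d7 * (Psi_tilde k - Psi_tilde (Suc k)) + d8 * c k + d6 * (if c k > d1 then 1 else 0)"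
proof -
  let ?W = "matrix_inv (H x_star)"
  let ?q = "(G (x k) \<bullet> (?W *v G (x k))) / gap_at k"
  define b where "b = 1 + (1 - ln d2) / (2 * d2 - 1 - d1)"
  define \<Delta> where "\<Delta> = Psi_tilde k - Psi_tilde (Suc k)"
  have "2 / (1 + c k) \<le> ?q"
    using gap_le_weighted_gradient[of "x k"] gap_at_pos[of k] c_nonneg[of k]
    by (simp add: c_def gap_at_def divide_simps) (simp add: mult_ac)
  then have "ln (2 / (1 + c k)) \<le> ln ?q" using c_nonneg[of k] by (intro ln_mono) auto
  moreover have "ln (2 / (1 + c k)) = ln 2 - ln (1 + c k)" using c_nonneg[of k] by (simp add: ln_div)
  moreover have "ln (1 + c k) \<le> c k" by (rule ln_add_one_self_le_self[OF c_nonneg])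
  ultimately have q: "ln 2 - c k \<le> ln ?q" by linarith
  have "ln (2 * (p k * n k)) = ln 2 + ln (p k * n k)" using pn_pos[of k] by (simp add: ln_mult_pos)
  then have "- ln (r k) \<le> - ln (2 * (p k * n k)) + \<Delta> + 2 * c k"
    using log_ratio_lower[OF spd_matrix_inv[OF hessian_spd[of x_star]], of k] q secant_tilde[of k]
    unfolding \<Delta>_def Psi_tilde_def by linarith
  moreover have "(d4 * d6 + d5) * omega (\<rho> k - 1) \<le> (d4 * d6 + d5) * (\<Delta> + 2 * c k)"
    unfolding \<Delta>_def using d4_pos d5_nonneg d6_nonneg by (intro mult_left_mono omega_rho_le) auto
  moreover note log_pn[of k, folded b_def]
  moreover have "d7 * \<Delta> + d8 * c k = \<Delta> + (d4 * d6 + d5) * (\<Delta> + 2 * c k) + 3 * c k + b * c k"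
    unfolding d8_eq b_def[symmetric] \<delta>7_def by (simp add: algebra_simps)
  ultimately show ?thesis unfolding \<Delta>_def[symmetric] using c_nonneg[of k] by linarith
qed

text \<open>
  The reserve \<open>c 0 / 14\<close> left by \<open>rate_slack\<close>, multiplied by \<open>\<delta>8 \<ge> 2 \<delta>4 \<delta>6\<close>, exceeds \<open>\<delta>6\<close> when
  \<open>c 0 > \<delta>1\<close>, because \<open>\<delta>4 \<delta>1 \<ge> 7\<close>; when \<open>c 0 \<le> \<delta>1\<close> no iteration has to be counted.
\<close>

lemma final_bound:
  assumes t: "t \<ge> 1"
  shows "gap_at t / gap_at 0 \<le> ((d7 * Psi_tilde 0 + (d6 + d8 * c 0) * Psi_bar 0
    + 3 * K * (d6 * ln_pos (c 0 / d1) + d8 * c 0)) / real t) ^ t"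
proof -
  define N where "N = real (card {k\<in>{..<t}. c k > d1})"
  define X where "X = d7 * Psi_tilde 0 + (d6 + d8 * c 0) * Psi_bar 0
    + 3 * K * (d6 * ln_pos (c 0 / d1) + d8 * c 0)"
  have d7: "d7 \<ge> 0" unfolding \<delta>7_def using d4_pos d5_nonneg d6_nonneg by simp
  have N: "(\<Sum>k<t. if c k > d1 then 1 else 0) = N"
    unfolding N_def by (simp flip: sum.inter_filter)
  have "(\<Sum>k<t. - ln (r k)) \<le> d7 * (Psi_tilde 0 - Psi_tilde t) + d8 * (\<Sum>k<t. c k)
      + d6 * (\<Sum>k<t. if c k > d1 then 1 else 0)"
  proof (induction t)
    case (Suc t)
    then show ?case using step_bound[of t] by (simp add: algebra_simps)
  qed simp
  also have "\<dots> \<le> d7 * Psi_tilde 0 + d8 * (c 0 * (Psi_bar 0 + (3 * K - 1 / 14))) + d6 * N"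
    unfolding N
  proof (intro add_mono mult_left_mono)
    show "(\<Sum>k<t. c k) \<le> c 0 * (Psi_bar 0 + (3 * K - 1 / 14))"
      using rate_slack c_nonneg[of 0] by (intro order_trans[OF sum_c] mult_left_mono) auto
  qed (use Psi_tilde_nonneg d7 d8_ge d6_nonneg in auto)
  also have "\<dots> \<le> X"
  proof -
    have "d6 * N \<le> d6 * (Psi_bar 0 + 3 * K * ln_pos (c 0 / d1)) + d8 * (c 0 * (1 / 14))"
    proof (cases "c 0 \<le> d1")
      case True
      then have "N = 0" unfolding N_def card_far(1)[OF True] by simp
      then show ?thesis using d6_nonneg d8_ge c_nonneg[of 0] Psi_bar_nonneg[of 0] K_ge
        by (auto simp: ln_pos_def intro!: add_nonneg_nonneg mult_nonneg_nonneg)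
    next
      case False
      have "d6 * (7 / 7) \<le> d6 * (d4 * d1 / 7)"
        using seven_le_d4_d1 d6_nonneg by (intro mult_left_mono) auto
      also have "\<dots> = 2 * (d4 * d6) * (d1 * (1 / 14))" by simp
      also have "\<dots> \<le> d8 * (c 0 * (1 / 14))"
        using False d8_ge d1_bounds by (intro mult_mono) auto
      finally have "d6 \<le> d8 * (c 0 * (1 / 14))" by simp
      moreover have "d6 * N \<le> d6 * (Psi_bar 0 + 3 * K * ln_pos (c 0 / d1) + 1)"
        unfolding N_def by (intro mult_left_mono card_far d6_nonneg)
      ultimately show ?thesis by (simp add: algebra_simps)
    qed
    then show ?thesis unfolding X_def by (simp add: algebra_simps)
  qed
  finally have X: "(\<Sum>k<t. - ln (r k)) \<le> X" .
  have "gap_at t / gap_at 0 = (\<Prod>k<t. 1 - r k)" using gap_at_prod[of t] gap_at_pos[of 0] by simp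
  also have "\<dots> \<le> (\<Prod>k<t. - ln (r k))"
  proof (intro prod_mono conjI)
    fix k
    show "0 \<le> 1 - r k" using r_less_one[of k] by simp
    show "1 - r k \<le> - ln (r k)" using ln_le_minus_one[OF r_pos[of k]] by linarith
  qed
  also have "\<dots> \<le> ((\<Sum>k<t. - ln (r k)) / real t) ^ t"
    using t log_ratio_nonpos by (intro prod_le_mean_power) auto
  also have "\<dots> \<le> (X / real t) ^ t"
    using X t log_ratio_nonpos
    by (intro power_mono divide_right_mono divide_nonneg_pos sum_nonneg) auto
  finally show ?thesis unfolding X_def .
qed

end

section \<open>The superlinear bound\<close>

theorem theorem6p4:
  fixes f :: "real^'n \<Rightarrow> real"
    and G :: "real^'n \<Rightarrow> real^'n"
    and H :: "real^'n \<Rightarrow> real^'n^'n"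
    and \<mu> L M \<kappa> \<alpha> \<beta> C0 :: real
    and x_star :: "real^'n"
    and \<eta> :: "nat \<Rightarrow> real"
    and x :: "nat \<Rightarrow> real^'n"
    and B :: "nat \<Rightarrow> real^'n^'n"
    and B_bar B_tilde :: "real^'n^'n"
    and t :: nat
  assumes gradient: "\<And>z. GDERIV f z :> G z"
    and hessian: "\<And>z. (G has_derivative (\<lambda>h. H z *v h)) (at z)"
    and "\<mu> > 0" and "strongly_convex \<mu> f"
    and "L > 0" and "L-lipschitz_on UNIV G"
    and "M > 0" and "\<And>z w. onorm (\<lambda>h. (H z - H w) *v h) \<le> M * norm (z - w)"
    and "\<kappa> = L / \<mu>"
    and minimizer: "\<And>z. f x_star \<le> f z"
    and "0 < \<alpha>" and "\<alpha> < \<beta>" and "\<beta> < 1" and "\<alpha> < 1 / 2"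
    and "spd (B 0)"
    and "bfgs_iteration G \<eta> x B"
    and nonoptimal: "\<And>k. G (x k) \<noteq> 0"
    and line_search:
      "\<And>k. armijo_wolfe \<alpha> \<beta> f G (x k) (bfgs_direction (B k) (G (x k))) (\<eta> k)"
    and unit_step:
      "\<And>k. armijo_wolfe \<alpha> \<beta> f G (x k) (bfgs_direction (B k) (G (x k))) 1 \<Longrightarrow> \<eta> k = 1"
    and "C0 = M / (\<mu> powr (3 / 2)) * sqrt (2 * (f (x 0) - f x_star))"
    and "B_bar = (1 / L) *\<^sub>R B 0"
    and "B_tilde = matrix_inv (spd_sqrt (H x_star)) ** B 0 ** matrix_inv (spd_sqrt (H x_star))"
    and "t \<ge> 1"
  shows "(f (x t) - f x_star) / (f (x 0) - f x_star)
    \<le> ((\<delta>7 \<alpha> \<beta> * Psi B_tilde + (\<delta>6 \<alpha> \<beta> + \<delta>8 \<alpha> \<beta> * C0) * Psi B_bar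
         + (3 * \<delta>6 \<alpha> \<beta> / (\<alpha> * (1 - \<beta>)) * ln_pos (C0 / \<delta>1 \<alpha> \<beta>)
            + 3 * \<delta>8 \<alpha> \<beta> / (\<alpha> * (1 - \<beta>)) * C0) * \<kappa>)
       / real t) ^ t"
proof -
  interpret run: bfgs_run f G H \<mu> L M x_star \<alpha> \<beta> \<eta> x B
    by unfold_locales (use assms in auto)
  have C0: "run.c 0 = C0" using assms by (simp add: run.c_def run.C_def run.gap_def)
  have tilde: "run.Psi_tilde 0 = Psi B_tilde"
    unfolding run.Psi_tilde_def using assms Psi_normalized[OF run.hessian_spd] by simp
  have "((1 / L) *\<^sub>R mat 1) ** B 0 = (1 / L) *\<^sub>R B 0"
    by (simp add: matrix_eq scaleR_matrix_vector_assoc[symmetric] flip: matrix_vector_mul_assoc)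
  then have bar: "run.Psi_bar 0 = Psi B_bar" using assms by (simp add: run.Psi_bar_def)
  have K: "3 * run.K * (\<delta>6 \<alpha> \<beta> * ln_pos (C0 / \<delta>1 \<alpha> \<beta>) + \<delta>8 \<alpha> \<beta> * C0)
    = (3 * \<delta>6 \<alpha> \<beta> / (\<alpha> * (1 - \<beta>)) * ln_pos (C0 / \<delta>1 \<alpha> \<beta>)
       + 3 * \<delta>8 \<alpha> \<beta> / (\<alpha> * (1 - \<beta>)) * C0) * \<kappa>"
    using \<open>\<kappa> = L / \<mu>\<close> by (simp add: run.K_def run.\<kappa>_def add_divide_distrib algebra_simps)
  show ?thesis
    using run.final_bound[OF \<open>t \<ge> 1\<close>] unfolding C0 tilde bar K
    by (simp only: run.gap_at_def run.gap_def)
qed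

end
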